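(* Consider $n$-qubit $2$-local Hamiltonians $H=\sum_{1\le j<k\le n}\beta_{j,k}Z_jZ_k$, where the real coefficients take arbitrary values up to $|\beta_{j,k}|\le t$. Given accuracy $0<\epsilon<1/3$, number of qubits $b\ge n$, and a $2$-qubit gate set $\mathcal{K}$ of finite size $|\mathcal{K}|$, if $t=\Omega(\epsilon)$, then $$\min\left\{g\ \middle|\ \forall\, H\text{ of this form},\ \exists\text{ circuit }V\text{ on }b\text{ qubits with }g\text{ gates from }\mathcal{K},\ \|e^{-iH}-V\|\le\epsilon\right\}=\Omega\left(\frac{n^2}{\log(b|\mathcal{K}|)}-n\,\mathrm{polylog}\left(\frac n\epsilon\right)\right).$$ If instead $\mathcal{K}$ is the set of arbitrary $2$-qubit gates (with all other hypotheses unchanged), then $$\min\left\{g\ \middle|\ \forall\, H\text{ of this form},\ \exists\text{ circuit }V\text{ on }b\text{ qubits with }g\text{ gates from }\mathcal{K},\ \|e^{-iH}-V\|\le\epsilon\right\}=\Omega\left(\frac{n^2}{\log b}-n\,\mathrm{polylog}\left(\frac n\epsilon\right)\right).$$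
   Context: $Z_j$ is the Pauli-$Z$ operator on qubit $j$. $\|\cdot\|$ is the spectral norm. A circuit $V$ on $b\ge n$ qubits approximating an $n$-qubit unitary $U$ to accuracy $\epsilon$ uses the $b-n$ extra qubits as ancillas initialized to and returned to $|0\rangle$: $\|U-V\|\le\epsilon$ means $\|V(I\otimes|0^{b-n}\rangle)-U\otimes|0^{b-n}\rangle\|\le\epsilon$. A circuit with $g$ gates from $\mathcal{K}$ is a product of $g$ gates, each being an element of $\mathcal{K}$ applied to some pair of the $b$ qubits. The minimum of the empty set is $+\infty$. The condition $t=\Omega(\epsilon)$ is understood with a sufficiently large implied constant (for smaller $t$ the identity circuit could suffice). *)

theory Defs
  imports
    "Jordan_Normal_Form.Schur_Decomposition"
    "HOL-Library.Extended_Real"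
begin

section \<open>Matrix norm, sum and exponential\<close>

definition l2_norm :: "complex vec \<Rightarrow> real" where
  "l2_norm v = sqrt (Re (v \<bullet>c v))"

definition spectral_norm :: "complex mat \<Rightarrow> real" where
  "spectral_norm A = Sup {l2_norm (A *\<^sub>v v) | v. v \<in> carrier_vec (dim_col A) \<and> l2_norm v \<le> 1}"

definition mat_sum :: "nat \<Rightarrow> nat \<Rightarrow> ('i \<Rightarrow> complex mat) \<Rightarrow> 'i set \<Rightarrow> complex mat" where
  "mat_sum r c f I = mat r c (\<lambda>ij. \<Sum>x\<in>I. f x $$ ij)"

text \<open>The power series of the exponential, summed entrywise.\<close>

definition mat_exp :: "complex mat \<Rightarrow> complex mat" where
  "mat_exp A = mat (dim_row A) (dim_row A) (\<lambda>ij. \<Sum>m. (A ^\<^sub>m m) $$ ij / of_nat (fact m))"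

section \<open>Qubits\<close>

text \<open>
  The state space of \<open>n\<close> qubits, numbered from \<open>0\<close> to \<open>n - 1\<close>, has dimension \<open>2 ^ n\<close>.
  The basis index \<open>x < 2 ^ n\<close> stands for the computational basis state in which
  qubit \<open>l\<close> has the value \<open>bit x l\<close>.
\<close>

definition on_qubit :: "nat \<Rightarrow> complex mat \<Rightarrow> nat \<Rightarrow> complex mat" where
  "on_qubit n A j = mat (2 ^ n) (2 ^ n) (\<lambda>(r, c).
     if \<forall>l<n. l \<noteq> j \<longrightarrow> bit r l = bit c l
     then A $$ (of_bool (bit r j), of_bool (bit c j)) else 0)"

text \<open>
  A two-qubit operator \<open>A\<close> acts on the ordered pair \<open>(j, k)\<close> in the basis
  \<open>|00>, |01>, |10>, |11>\<close>, where the first digit belongs to qubit \<open>j\<close>.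
\<close>

definition on_qubits :: "nat \<Rightarrow> complex mat \<Rightarrow> nat \<Rightarrow> nat \<Rightarrow> complex mat" where
  "on_qubits n A j k = mat (2 ^ n) (2 ^ n) (\<lambda>(r, c).
     if \<forall>l<n. l \<noteq> j \<and> l \<noteq> k \<longrightarrow> bit r l = bit c l
     then A $$ (2 * of_bool (bit r j) + of_bool (bit r k),
                2 * of_bool (bit c j) + of_bool (bit c k)) else 0)"

text \<open>
  \<open>A \<otimes> |0\<dots>0>\<close> on \<open>b\<close> qubits, for \<open>A\<close> with values in the space of the first \<open>n\<close> qubits: in the
  basis numbering above, the basis state \<open>x < 2 ^ n\<close> with all further qubits set to \<open>0\<close> is again
  number \<open>x\<close>, so \<open>A\<close> is padded with zero rows.
\<close>

definition with_ancillas :: "nat \<Rightarrow> complex mat \<Rightarrow> complex mat" where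
  "with_ancillas b A = mat (2 ^ b) (dim_col A) (\<lambda>(r, c). if r < dim_row A then A $$ (r, c) else 0)"

section \<open>Circuits\<close>

definition two_qubit_gates :: "complex mat set" where
  "two_qubit_gates = {U \<in> carrier_mat 4 4. mat_adjoint U * U = 1\<^sub>m 4}"

definition is_circuit :: "nat \<Rightarrow> complex mat set \<Rightarrow> nat \<Rightarrow> complex mat \<Rightarrow> bool" where
  "is_circuit b K g V \<longleftrightarrow>
     (\<exists>gs :: (complex mat \<times> nat \<times> nat) list. length gs = g \<and>
        (\<forall>(G, j, k) \<in> set gs. G \<in> K \<and> j < b \<and> k < b \<and> j \<noteq> k) \<and>
        V = foldr (\<lambda>(G, j, k) M. on_qubits b G j k * M) gs (1\<^sub>m (2 ^ b)))"

definition approximates :: "nat \<Rightarrow> nat \<Rightarrow> real \<Rightarrow> complex mat \<Rightarrow> complex mat \<Rightarrow> bool" where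
  "approximates n b \<epsilon> V U \<longleftrightarrow>
     spectral_norm (V * with_ancillas b (1\<^sub>m (2 ^ n)) - with_ancillas b U) \<le> \<epsilon>"

section \<open>The Hamiltonians and their gate complexity\<close>

definition pauli_Z :: "complex mat" where
  "pauli_Z = mat_of_rows_list 2 [[1, 0], [0, -1]]"

definition zz_hamiltonian :: "nat \<Rightarrow> (nat \<Rightarrow> nat \<Rightarrow> real) \<Rightarrow> complex mat" where
  "zz_hamiltonian n \<beta> = mat_sum (2 ^ n) (2 ^ n)
     (\<lambda>(j, k). complex_of_real (\<beta> j k) \<cdot>\<^sub>m (on_qubit n pauli_Z j * on_qubit n pauli_Z k))
     {(j, k). j < k \<and> k < n}"

definition zz_hamiltonians :: "nat \<Rightarrow> real \<Rightarrow> complex mat set" where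
  "zz_hamiltonians n t = {zz_hamiltonian n \<beta> | \<beta>. \<forall>j k. j < k \<and> k < n \<longrightarrow> \<bar>\<beta> j k\<bar> \<le> t}"

text \<open>\<open>Inf\<close> on \<^typ>\<open>enat\<close> is the minimum of a nonempty set and \<open>\<infinity>\<close> for the empty set.\<close>

definition min_gates :: "nat \<Rightarrow> nat \<Rightarrow> real \<Rightarrow> real \<Rightarrow> complex mat set \<Rightarrow> enat" where
  "min_gates n b \<epsilon> t K = Inf (enat ` {g. \<forall>H \<in> zz_hamiltonians n t.
     \<exists>V. is_circuit b K g V \<and> approximates n b \<epsilon> V (mat_exp ((- \<i>) \<cdot>\<^sub>m H))})"

end

theory Submission
  imports Defs
begin

text \<open>
  The energy \<open>E\<close> of a Hamiltonian satisfies \<open>E(0) + E(jk) - E(j) - E(k) = 4 \<beta> j k\<close>, where the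
  arguments are the basis states with at most the qubits \<open>j\<close> and \<open>k\<close> flipped. Hence the product
  of the four corresponding diagonal entries of an approximating circuit, two of them conjugated,
  reveals the sign of \<open>\<beta> j k = \<plusminus> 6/5 \<epsilon>\<close> in its imaginary part, with a margin proportional
  to \<open>\<epsilon>\<close>. For a finite gate set, all \<open>2 ^ (n (n - 1) / 2)\<close> sign patterns therefore need
  different circuits, and there are at most \<open>(b\<^sup>2 * card K) ^ g\<close> circuits.

  For arbitrary gates fix the wiring, one of at most \<open>b ^ (2 g)\<close>. The rescaled imaginary parts
  are polynomials \<open>F\<close> in the \<open>32 g\<close> gate entries and their conjugates, of degree at most 2 in
  each, and they approximate the sign bits with a margin that does not depend on \<open>\<epsilon>\<close>. The
  products of the \<open>F p\<close> and \<open>1 - F p\<close> over all pairs \<open>p\<close>, one for each sign pattern, evaluated at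
  the circuits give a row-stochastic matrix with a large trace. Its trace is at most its rank, and
  its rank is at most the number of monomials of degree at most \<open>n (n - 1)\<close> in each of the
  \<open>32 g\<close> variables. Thus a constant above 1 to the power \<open>n (n - 1) / 2\<close> is bounded by
  \<open>b ^ (66 g)\<close>. In this way no net of gates, and so no logarithm of \<open>1 / \<epsilon>\<close>, is needed.
\<close>

section \<open>Traces\<close>

lemma sum_diag_mult_commute:
  fixes A B :: "'a :: comm_semiring_0 mat"
  assumes A: "A \<in> carrier_mat n m" and B: "B \<in> carrier_mat m n"
  shows "(\<Sum>i<n. (A * B) $$ (i, i)) = (\<Sum>i<m. (B * A) $$ (i, i))"
proof -
  have "(\<Sum>i<n. (A * B) $$ (i, i)) = (\<Sum>i<n. \<Sum>k<m. A $$ (i, k) * B $$ (k, i))"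
    using A B by (intro sum.cong refl) (auto simp: scalar_prod_def atLeast0LessThan)
  also have "\<dots> = (\<Sum>k<m. \<Sum>i<n. B $$ (k, i) * A $$ (i, k))"
    by (subst sum.swap) (simp add: mult.commute)
  also have "\<dots> = (\<Sum>i<m. (B * A) $$ (i, i))"
    using A B by (intro sum.cong refl) (auto simp: scalar_prod_def atLeast0LessThan)
  finally show ?thesis .
qed

text \<open>Schur triangularization turns the trace into the sum of the \<open>r\<close> diagonal
  entries of \<open>B\<close>, which are roots of the characteristic polynomial and so eigenvalues
  of \<open>A\<close>.\<close>

lemma norm_sum_diag_le_dim:
  fixes A :: "complex mat"
  assumes A: "A \<in> carrier_mat r r"
    and ev: "\<And>k. eigenvalue A k \<Longrightarrow> cmod k \<le> 1"
  shows "cmod (\<Sum>i<r. A $$ (i, i)) \<le> r"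
proof -
  obtain as where as: "char_poly A = (\<Prod>a\<leftarrow>as. [:- a, 1:])"
    using char_poly_factorized[OF A] by blast
  obtain B P Q where s: "schur_decomposition A as = (B, P, Q)"
    by (cases "schur_decomposition A as") auto
  note sd = schur_decomposition[OF A as s]
  have wit: "similar_mat_wit A B P Q" and diag: "diag_mat B = as"
    using sd by auto
  note w = similar_mat_witD2[OF A wit]
  have "(\<Sum>i<r. A $$ (i, i)) = (\<Sum>i<r. (P * (B * Q)) $$ (i, i))"
    using w by (simp add: assoc_mult_mat)
  also have "\<dots> = (\<Sum>i<r. ((B * Q) * P) $$ (i, i))"
    by (rule sum_diag_mult_commute) (use w in auto)
  also have "(B * Q) * P = B"
    using w by (simp add: assoc_mult_mat[of B r r Q r P r])
  finally have eq: "(\<Sum>i<r. A $$ (i, i)) = (\<Sum>i<r. B $$ (i, i))" .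
  have "cmod (B $$ (i, i)) \<le> 1" if "i < r" for i
  proof (rule ev)
    have "B $$ (i, i) \<in> set as"
      using that w unfolding diag[symmetric] diag_mat_def by auto
    then show "eigenvalue A (B $$ (i, i))"
      unfolding eigenvalue_root_char_poly[OF A] as
      by (auto simp: poly_prod_list prod_list_zero_iff o_def)
  qed
  then have "(\<Sum>i<r. cmod (B $$ (i, i))) \<le> (\<Sum>i<r. 1)"
    by (intro sum_mono) auto
  then show ?thesis
    unfolding eq using norm_sum[of "\<lambda>i. B $$ (i, i)" "{..<r}"] by simp
qed

text \<open>Compare both sides of the eigenvector equation at a coordinate of largest
  modulus.\<close>

lemma eigenvalue_norm_le_row_sum:
  fixes M :: "complex mat"
  assumes M: "M \<in> carrier_mat s s"
    and row: "\<And>i. i < s \<Longrightarrow> (\<Sum>j<s. cmod (M $$ (i, j))) \<le> 1"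
    and x: "x \<in> carrier_vec s" "x \<noteq> 0\<^sub>v s" "M *\<^sub>v x = k \<cdot>\<^sub>v x"
  shows "cmod k \<le> 1"
proof -
  obtain i0 where i0: "i0 < s" "x $ i0 \<noteq> 0"
    using x by (metis carrier_vecD eq_vecI index_zero_vec(1) index_zero_vec(2))
  define m where "m = Max ((\<lambda>i. cmod (x $ i)) ` {..<s})"
  have "m \<in> (\<lambda>i. cmod (x $ i)) ` {..<s}"
    unfolding m_def using i0 by (intro Max_in) auto
  then obtain i where i: "i < s" "m = cmod (x $ i)" by auto
  have le: "cmod (x $ j) \<le> m" if "j < s" for j
    unfolding m_def using that by (intro Max_ge) auto
  have "m > 0" using le[OF i0(1)] i0(2) by (meson less_le_trans zero_less_norm_iff)
  have "k * x $ i = (M *\<^sub>v x) $ i"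
    unfolding x(3) using i x(1) by simp
  also have "\<dots> = (\<Sum>j<s. M $$ (i, j) * x $ j)"
    using i M x(1) by (simp add: scalar_prod_def atLeast0LessThan)
  finally have "k * x $ i = (\<Sum>j<s. M $$ (i, j) * x $ j)" .
  then have "cmod k * m = cmod (\<Sum>j<s. M $$ (i, j) * x $ j)"
    using i by (metis norm_mult)
  also have "\<dots> \<le> (\<Sum>j<s. cmod (M $$ (i, j)) * m)"
    by (rule sum_norm_le) (auto simp: norm_mult intro!: mult_left_mono le)
  also have "\<dots> \<le> 1 * m"
    unfolding sum_distrib_right[symmetric] using row[OF i(1)] \<open>m > 0\<close>
    by (intro mult_right_mono) auto
  finally show ?thesis using \<open>m > 0\<close> by simp
qed

text \<open>
  \<open>M = U C\<close> and \<open>C U\<close> have the same trace and the same nonzero eigenvalues, and the latter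
  matrix has only \<open>r\<close> eigenvalues.
\<close>

lemma norm_sum_diag_le_inner_dim:
  fixes U C :: "complex mat"
  assumes U: "U \<in> carrier_mat s r" and C: "C \<in> carrier_mat r s"
    and row: "\<And>i. i < s \<Longrightarrow> (\<Sum>j<s. cmod ((U * C) $$ (i, j))) \<le> 1"
  shows "cmod (\<Sum>i<s. (U * C) $$ (i, i)) \<le> r"
  unfolding sum_diag_mult_commute[OF U C]
proof (rule norm_sum_diag_le_dim)
  show CU: "C * U \<in> carrier_mat r r" using U C by auto
  fix k assume "eigenvalue (C * U) k"
  then obtain v where v: "v \<in> carrier_vec r" "v \<noteq> 0\<^sub>v r" "C * U *\<^sub>v v = k \<cdot>\<^sub>v v"
    using CU U C unfolding eigenvalue_def eigenvector_def by auto
  have CUv: "C *\<^sub>v (U *\<^sub>v v) = k \<cdot>\<^sub>v v"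
    using assoc_mult_mat_vec[OF C U v(1)] v(3) by simp
  show "cmod k \<le> 1"
  proof (cases "k = 0")
    case False
    show ?thesis
    proof (rule eigenvalue_norm_le_row_sum[of "U * C" s "U *\<^sub>v v" k])
      show "U *\<^sub>v v \<noteq> 0\<^sub>v s"
      proof
        assume "U *\<^sub>v v = 0\<^sub>v s"
        moreover have "C *\<^sub>v 0\<^sub>v s = 0\<^sub>v r" using C by (intro eq_vecI) auto
        ultimately have "k \<cdot>\<^sub>v v = 0\<^sub>v r" using CUv by simp
        then show False using False v(1,2) 
          by (metis (no_types, lifting) carrier_vecD eq_vecI index_smult_vec(1) index_zero_vec mult_eq_0_iff)
      qed
      show "U * C *\<^sub>v (U *\<^sub>v v) = k \<cdot>\<^sub>v (U *\<^sub>v v)"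
        using assoc_mult_mat_vec[OF U C, of "U *\<^sub>v v"] CUv U v(1)
        by (auto simp: mult_mat_vec)
    qed (use U C v row in auto)
  qed simp
qed

text \<open>The form in which the rank bound is applied: \<open>S\<close> will consist of sign
  patterns and \<open>E\<close> of monomials, so that the number of monomials bounds the
  trace.\<close>

lemma norm_trace_le_card:
  fixes u :: "'a \<Rightarrow> 'e \<Rightarrow> complex" and c :: "'e \<Rightarrow> 'a \<Rightarrow> complex"
  assumes S: "finite S" and E: "finite E"
    and row: "\<And>a. a \<in> S \<Longrightarrow> (\<Sum>b\<in>S. cmod (\<Sum>e\<in>E. u a e * c e b)) \<le> 1"
  shows "cmod (\<Sum>a\<in>S. \<Sum>e\<in>E. u a e * c e a) \<le> card E"
proof -
  obtain f where f: "bij_betw f {..<card S} S"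
    using ex_bij_betw_nat_finite[OF S] by (auto simp: atLeast0LessThan)
  obtain h where h: "bij_betw h {..<card E} E"
    using ex_bij_betw_nat_finite[OF E] by (auto simp: atLeast0LessThan)
  define U where "U = mat (card S) (card E) (\<lambda>(i, k). u (f i) (h k))"
  define C where "C = mat (card E) (card S) (\<lambda>(k, i). c (h k) (f i))"
  have UC: "(U * C) $$ (i, j) = (\<Sum>e\<in>E. u (f i) e * c e (f j))"
    if "i < card S" "j < card S" for i j
    using that sum.reindex_bij_betw[OF h, of "\<lambda>e. u (f i) e * c e (f j)"]
    by (simp add: U_def C_def scalar_prod_def atLeast0LessThan)
  have "cmod (\<Sum>i<card S. (U * C) $$ (i, i)) \<le> card E"
  proof (rule norm_sum_diag_le_inner_dim)
    fix i assume i: "i < card S"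
    have "(\<Sum>j<card S. cmod ((U * C) $$ (i, j)))
      = (\<Sum>j<card S. cmod (\<Sum>e\<in>E. u (f i) e * c e (f j)))"
      using i UC by (intro sum.cong) auto
    also have "\<dots> = (\<Sum>b\<in>S. cmod (\<Sum>e\<in>E. u (f i) e * c e b))"
      by (rule sum.reindex_bij_betw[OF f])
    also have "\<dots> \<le> 1" using f i by (intro row) (auto simp: bij_betw_def)
    finally show "(\<Sum>j<card S. cmod ((U * C) $$ (i, j))) \<le> 1" .
  qed (auto simp: U_def C_def)
  also have "(\<Sum>i<card S. (U * C) $$ (i, i)) = (\<Sum>i<card S. \<Sum>e\<in>E. u (f i) e * c e (f i))"
    using UC by (intro sum.cong) auto
  also have "\<dots> = (\<Sum>a\<in>S. \<Sum>e\<in>E. u a e * c e a)"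
    by (rule sum.reindex_bij_betw[OF f])
  finally show ?thesis .
qed

section \<open>Polynomials of bounded degree in each variable\<close>

text \<open>Separate degree bounds for the variables add up under products and make the monomials
  easy to count. \<open>PiE\<close> lists each exponent vector on \<open>I\<close> exactly
  once.\<close>

definition polys :: "'i set \<Rightarrow> ('i \<Rightarrow> nat) \<Rightarrow> (('i \<Rightarrow> complex) \<Rightarrow> complex) set" where
  "polys I D = {f. \<exists>c. f = (\<lambda>z. \<Sum>e\<in>PiE I (\<lambda>i. {..D i}). c e * (\<Prod>i\<in>I. z i ^ e i))}"

context
  fixes I :: "'i set"
  assumes I: "finite I"
begin

lemma finite_exponents: "finite (PiE I (\<lambda>i. {..D i :: nat}))"
  using I by (intro finite_PiE) auto

lemma polys_zero: "(\<lambda>z. 0) \<in> polys I D"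
  unfolding polys_def by (auto intro!: exI[of _ "\<lambda>_. 0"])

lemma polys_add:
  assumes "f \<in> polys I D" "g \<in> polys I D"
  shows "(\<lambda>z. f z + g z) \<in> polys I D"
proof -
  obtain c d where "f = (\<lambda>z. \<Sum>e\<in>PiE I (\<lambda>i. {..D i}). c e * (\<Prod>i\<in>I. z i ^ e i))"
    "g = (\<lambda>z. \<Sum>e\<in>PiE I (\<lambda>i. {..D i}). d e * (\<Prod>i\<in>I. z i ^ e i))"
    using assms unfolding polys_def by auto
  then show ?thesis unfolding polys_def
    by (auto intro!: exI[of _ "\<lambda>e. c e + d e"] simp: sum.distrib distrib_right)
qed

lemma polys_scale:
  assumes "f \<in> polys I D"
  shows "(\<lambda>z. a * f z) \<in> polys I D"
proof -
  obtain c where "f = (\<lambda>z. \<Sum>e\<in>PiE I (\<lambda>i. {..D i}). c e * (\<Prod>i\<in>I. z i ^ e i))"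
    using assms unfolding polys_def by auto
  then show ?thesis unfolding polys_def
    by (auto intro!: exI[of _ "\<lambda>e. a * c e"] simp: sum_distrib_left mult.assoc)
qed

lemma polys_sum:
  assumes "\<And>x. x \<in> X \<Longrightarrow> f x \<in> polys I D"
  shows "(\<lambda>z. \<Sum>x\<in>X. f x z) \<in> polys I D"
  using assms
  by (induction X rule: infinite_finite_induct) (auto intro: polys_zero polys_add)

lemma polys_monomial:
  assumes "\<And>i. i \<in> I \<Longrightarrow> e i \<le> D i"
  shows "(\<lambda>z. \<Prod>i\<in>I. z i ^ e i) \<in> polys I D"
proof -
  \<comment> \<open>Membership in \<open>PiE\<close> requires the default value outside
    \<open>I\<close>, where \<open>e\<close> is arbitrary.\<close>
  let ?e = "restrict e I"
  have mem: "?e \<in> PiE I (\<lambda>i. {..D i})" using assms by auto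
  have "(\<Sum>d\<in>PiE I (\<lambda>i. {..D i}). (if d = ?e then 1 else 0) * (\<Prod>i\<in>I. z i ^ d i))
      = (\<Prod>i\<in>I. z i ^ e i)" for z :: "'i \<Rightarrow> complex"
  proof -
    have "(\<Sum>d\<in>PiE I (\<lambda>i. {..D i}). (if d = ?e then 1 else 0) * (\<Prod>i\<in>I. z i ^ d i))
      = (\<Sum>d\<in>PiE I (\<lambda>i. {..D i}). if d = ?e then (\<Prod>i\<in>I. z i ^ d i) else 0)"
      by (intro sum.cong) auto
    also have "\<dots> = (\<Prod>i\<in>I. z i ^ ?e i)"
      using mem finite_exponents by simp
    finally show ?thesis by (simp cong: prod.cong)
  qed
  then show ?thesis unfolding polys_def
    by (auto intro!: exI[of _ "\<lambda>d. if d = ?e then 1 else 0"])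
qed

lemma polys_mono:
  assumes "f \<in> polys I D" "\<And>i. i \<in> I \<Longrightarrow> D i \<le> D' i"
  shows "f \<in> polys I D'"
proof -
  obtain c where c: "f = (\<lambda>z. \<Sum>e\<in>PiE I (\<lambda>i. {..D i}). c e * (\<Prod>i\<in>I. z i ^ e i))"
    using assms unfolding polys_def by auto
  show ?thesis unfolding c
  proof (intro polys_sum polys_scale polys_monomial)
    fix e i assume "e \<in> PiE I (\<lambda>i. {..D i})" "i \<in> I"
    then show "e i \<le> D' i" using assms(2)[of i] by (auto simp: PiE_iff intro: order.trans)
  qed
qed

lemma polys_const: "(\<lambda>z. a) \<in> polys I D"
  using polys_scale[OF polys_monomial[of "\<lambda>_. 0" D], of a] by simp

lemma polys_var:
  assumes "i \<in> I" "1 \<le> D i"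
  shows "(\<lambda>z. z i) \<in> polys I D"
proof -
  have "(\<Prod>j\<in>I. z j ^ (if j = i then 1 else 0)) = z i" for z :: "'i \<Rightarrow> complex"
    using prod.delta[OF I, of i z] assms(1) by (simp add: if_distrib cong: if_cong)
  then show ?thesis
    using polys_monomial[of "\<lambda>j. if j = i then 1 else 0" D] assms by simp
qed

lemma polys_mult:
  assumes "f \<in> polys I D" "g \<in> polys I D'"
  shows "(\<lambda>z. f z * g z) \<in> polys I (\<lambda>i. D i + D' i)"
proof -
  let ?E = "PiE I (\<lambda>i. {..D i})" and ?E' = "PiE I (\<lambda>i. {..D' i})"
  obtain c d where f: "f = (\<lambda>z. \<Sum>e\<in>?E. c e * (\<Prod>i\<in>I. z i ^ e i))"
    and g: "g = (\<lambda>z. \<Sum>e\<in>?E'. d e * (\<Prod>i\<in>I. z i ^ e i))"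
    using assms unfolding polys_def by auto
  have "(\<lambda>z. f z * g z)
    = (\<lambda>z. \<Sum>e\<in>?E. \<Sum>e'\<in>?E'. c e * d e' * (\<Prod>i\<in>I. z i ^ (e i + e' i)))"
    unfolding f g by (auto simp: sum_product prod.distrib power_add mult_ac)
  also have "\<dots> \<in> polys I (\<lambda>i. D i + D' i)"
  proof (intro polys_sum polys_scale polys_monomial)
    fix e e' i assume "e \<in> ?E" "e' \<in> ?E'" "i \<in> I"
    then have "e i \<le> D i" "e' i \<le> D' i" by (auto simp: PiE_iff)
    then show "e i + e' i \<le> D i + D' i" by simp
  qed
  finally show ?thesis .
qed

lemma polys_prod:
  assumes "finite X" "\<And>x. x \<in> X \<Longrightarrow> f x \<in> polys I D"
  shows "(\<lambda>z. \<Prod>x\<in>X. f x z) \<in> polys I (\<lambda>i. card X * D i)"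
  using assms
proof (induction X rule: finite_induct)
  case empty
  then show ?case using polys_const[of 1] by simp
next
  case (insert x X)
  then have "(\<lambda>z. f x z * (\<Prod>x\<in>X. f x z)) \<in> polys I (\<lambda>i. D i + card X * D i)"
    by (intro polys_mult) auto
  then show ?case using insert by simp
qed

end

text \<open>Serves to exchange gate entries with their conjugates. As \<open>\<pi>\<close> is its
  own inverse on \<open>I\<close>, the substitution turns the exponents \<open>e\<close> into
  \<open>\<lambda>i. e (\<pi> i)\<close>.\<close>

lemma polys_reindex:
  fixes \<pi> :: "'i \<Rightarrow> 'i"
  assumes I: "finite I" and \<pi>: "bij_betw \<pi> I I" "\<And>i. i \<in> I \<Longrightarrow> \<pi> (\<pi> i) = i"
    and f: "f \<in> polys I D"
  shows "(\<lambda>z. f (\<lambda>i. z (\<pi> i))) \<in> polys I (\<lambda>i. D (\<pi> i))"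
proof -
  let ?E = "PiE I (\<lambda>i. {..D i})"
  obtain c where f: "f = (\<lambda>z. \<Sum>e\<in>?E. c e * (\<Prod>i\<in>I. z i ^ e i))"
    using assms unfolding polys_def by auto
  have eq: "(\<Prod>i\<in>I. z (\<pi> i) ^ e i) = (\<Prod>i\<in>I. z i ^ e (\<pi> i))"
    for z :: "'i \<Rightarrow> complex" and e
    using prod.reindex_bij_betw[OF \<pi>(1), of "\<lambda>i. z i ^ e (\<pi> i)"] \<pi>(2) by simp
  show ?thesis unfolding f eq
  proof (intro polys_sum polys_scale polys_monomial I)
    fix e i assume "e \<in> ?E" "i \<in> I"
    then show "e (\<pi> i) \<le> D (\<pi> i)" using \<pi>(1) by (auto simp: PiE_iff bij_betw_def)
  qed
qed

section \<open>Approximating the vertices of a cube by polynomials\<close>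

text \<open>
  The products \<open>l b = (\<Prod>p\<in>b. F p) * (\<Prod>p\<in>P - b. 1 - F p)\<close> give a row-stochastic matrix
  \<open>l b (z a)\<close> with diagonal entries at least \<open>(1/2 + \<eta>) ^ card P\<close>, whose rank is at most the
  dimension of the space of polynomials containing the \<open>l b\<close>.
\<close>

lemma card_cube_vertices_bound:
  fixes F :: "'p \<Rightarrow> ('i \<Rightarrow> complex) \<Rightarrow> complex" and y :: "'p set \<Rightarrow> 'p \<Rightarrow> real"
  assumes I: "finite I" and P: "finite P" and S: "S \<subseteq> Pow P"
    and F: "\<And>p. p \<in> P \<Longrightarrow> F p \<in> polys I D"
    and y: "\<And>a p. a \<in> S \<Longrightarrow> p \<in> P \<Longrightarrow> F p (z a) = complex_of_real (y a p)"
    and y01: "\<And>a p. a \<in> S \<Longrightarrow> p \<in> P \<Longrightarrow> 0 \<le> y a p \<and> y a p \<le> 1"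
    and \<eta>: "0 \<le> \<eta>"
    and y_in: "\<And>a p. a \<in> S \<Longrightarrow> p \<in> a \<Longrightarrow> y a p \<ge> 1 / 2 + \<eta>"
    and y_out: "\<And>a p. a \<in> S \<Longrightarrow> p \<in> P - a \<Longrightarrow> y a p \<le> 1 / 2 - \<eta>"
  shows "card S * (1 / 2 + \<eta>) ^ card P \<le> (\<Prod>i\<in>I. card P * D i + 1)"
proof -
  define E where "E = PiE I (\<lambda>i. {..card P * D i})"
  have finE: "finite E" unfolding E_def using I by (intro finite_PiE) auto
  have finS: "finite S" using S P by (meson finite_Pow_iff finite_subset)
  define L where "L b w = (\<Prod>p\<in>b. F p w) * (\<Prod>p\<in>P - b. 1 - F p w)" for b w
  define l where "l b a = (\<Prod>p\<in>b. y a p) * (\<Prod>p\<in>P - b. 1 - y a p)" for b a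
  have L: "L b \<in> polys I (\<lambda>i. card P * D i)" if "b \<in> S" for b
  proof -
    have b: "b \<subseteq> P" "finite b" using that S P by (auto intro: finite_subset)
    have "(\<lambda>w. 1 + (-1) * F p w) \<in> polys I D" if "p \<in> P" for p
      by (intro polys_add polys_scale polys_const I F that)
    then have "L b \<in> polys I (\<lambda>i. card b * D i + card (P - b) * D i)"
      unfolding L_def using F b P
      by (intro polys_mult[OF I] polys_prod[OF I]) auto
    \<comment> \<open>A pattern and its complement together use each element of \<open>P\<close>
      once, so all \<open>L b\<close> lie in one and the same space.\<close>
    moreover have "card b * D i + card (P - b) * D i = card P * D i" for i
      using b P by (simp add: card_Diff_subset card_mono flip: distrib_right)
    ultimately show ?thesis by simp
  qed
  then have "\<forall>b\<in>S. \<exists>c. L b = (\<lambda>z. \<Sum>e\<in>E. c e * (\<Prod>i\<in>I. z i ^ e i))"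
    unfolding polys_def E_def by auto
  then obtain c where c: "\<And>b. b \<in> S \<Longrightarrow> L b = (\<lambda>z. \<Sum>e\<in>E. c b e * (\<Prod>i\<in>I. z i ^ e i))"
    by (metis (no_types))
  have Ll: "L b (z a) = complex_of_real (l b a)" if "a \<in> S" "b \<in> S" for a b
  proof -
    have b: "b \<subseteq> P" using that S by auto
    have "(\<Prod>p\<in>b. F p (z a)) = (\<Prod>p\<in>b. complex_of_real (y a p))"
      using that b y by (intro prod.cong) auto
    moreover have "(\<Prod>p\<in>P - b. 1 - F p (z a)) = (\<Prod>p\<in>P - b. 1 - complex_of_real (y a p))"
      using that b y by (intro prod.cong) auto
    ultimately show ?thesis unfolding L_def l_def by simp
  qed
  have l_nonneg: "0 \<le> l b a" if "a \<in> S" "b \<subseteq> P" for a b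
    unfolding l_def using that y01 by (intro mult_nonneg_nonneg prod_nonneg) (auto simp: subset_iff)
  have entry: "(\<Sum>e\<in>E. (\<Prod>i\<in>I. z a i ^ e i) * c b e) = complex_of_real (l b a)"
    if "a \<in> S" "b \<in> S" for a b
    using c[OF that(2)] Ll[OF that] by (simp add: mult.commute)
  have "cmod (\<Sum>a\<in>S. \<Sum>e\<in>E. (\<Prod>i\<in>I. z a i ^ e i) * c a e) \<le> card E"
  proof (rule norm_trace_le_card[OF finS finE, of "\<lambda>a e. \<Prod>i\<in>I. z a i ^ e i" "\<lambda>e b. c b e"])
    fix a assume a: "a \<in> S"
    have "(\<Sum>b\<in>S. cmod (\<Sum>e\<in>E. (\<Prod>i\<in>I. z a i ^ e i) * c b e)) = (\<Sum>b\<in>S. l b a)"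
      using entry a l_nonneg S by (intro sum.cong) auto
    \<comment> \<open>Over all subsets of \<open>P\<close> the sum factors into the product of the
      \<open>y a p + (1 - y a p)\<close>, which is 1.\<close>
    also have "\<dots> \<le> (\<Sum>b\<in>Pow P. l b a)"
      using S P l_nonneg a by (intro sum_mono2) auto
    also have "\<dots> = (\<Prod>p\<in>P. y a p + (1 - y a p))"
      unfolding l_def by (subst prod_add[OF P]) simp
    finally show "(\<Sum>b\<in>S. cmod (\<Sum>e\<in>E. (\<Prod>i\<in>I. z a i ^ e i) * c b e)) \<le> 1" by simp
  qed
  also have "(\<Sum>a\<in>S. \<Sum>e\<in>E. (\<Prod>i\<in>I. z a i ^ e i) * c a e) = complex_of_real (\<Sum>a\<in>S. l a a)"
    using entry by simp
  also have "cmod \<dots> = (\<Sum>a\<in>S. l a a)"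
    using l_nonneg S by (subst norm_of_real) (auto intro!: abs_of_nonneg sum_nonneg)
  finally have trace: "(\<Sum>a\<in>S. l a a) \<le> card E" .
  have diag: "(1 / 2 + \<eta>) ^ card P \<le> l a a" if a: "a \<in> S" for a
  proof -
    have aP: "a \<subseteq> P" "finite a" using a S P by (auto intro: finite_subset)
    have "(1 / 2 + \<eta>) ^ card P = (\<Prod>p\<in>a. 1 / 2 + \<eta>) * (\<Prod>p\<in>P - a. 1 / 2 + \<eta>)"
      using aP P by (simp add: card_Diff_subset card_mono flip: power_add)
    also have "\<dots> \<le> l a a"
      unfolding l_def using \<eta> y_in[OF a] y_out[OF a] 
      by (intro mult_mono prod_mono prod_nonneg) (force simp: algebra_simps)+
    finally show ?thesis .
  qed
  have "card S * (1 / 2 + \<eta>) ^ card P = (\<Sum>a\<in>S. (1 / 2 + \<eta>) ^ card P)" by simp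
  also have "\<dots> \<le> (\<Sum>a\<in>S. l a a)" using diag by (intro sum_mono) auto
  also note trace
  also have "card E = (\<Prod>i\<in>I. card P * D i + 1)"
    unfolding E_def using I by (simp add: card_PiE)
  finally show ?thesis by simp
qed

section \<open>Matrix entries and the spectral norm\<close>

lemma l2_norm_eq: "l2_norm v = sqrt (\<Sum>i<dim_vec v. (cmod (v $ i))\<^sup>2)"
  unfolding l2_norm_def scalar_prod_def
  by (simp add: atLeast0LessThan complex_norm_square[symmetric] flip: of_real_power)

lemma norm_index_le_l2_norm: "i < dim_vec v \<Longrightarrow> cmod (v $ i) \<le> l2_norm v"
  unfolding l2_norm_eq by (intro real_le_rsqrt member_le_sum) auto

text \<open>The entry is a coordinate of the image of a unit vector. A crude bound by row sums shows
  first that the set under \<open>Sup\<close> is bounded above.\<close>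

lemma norm_entry_le_spectral_norm:
  assumes A: "A \<in> carrier_mat r c" and i: "i < r" and j: "j < c"
  shows "cmod (A $$ (i, j)) \<le> spectral_norm A"
proof -
  let ?X = "{l2_norm (A *\<^sub>v v) | v. v \<in> carrier_vec (dim_col A) \<and> l2_norm v \<le> 1}"
  have "bdd_above ?X"
  proof (rule bdd_aboveI)
    fix y assume "y \<in> ?X"
    then obtain v where v: "y = l2_norm (A *\<^sub>v v)" "v \<in> carrier_vec c" "l2_norm v \<le> 1"
      using A by auto
    have "cmod ((A *\<^sub>v v) $ k) \<le> (\<Sum>l<c. cmod (A $$ (k, l)))" if "k < r" for k
    proof -
      have "(A *\<^sub>v v) $ k = (\<Sum>l<c. A $$ (k, l) * v $ l)"
        using that A v(2) by (simp add: scalar_prod_def atLeast0LessThan)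
      also have "cmod \<dots> \<le> (\<Sum>l<c. cmod (A $$ (k, l)))"
      proof (rule sum_norm_le)
        fix l assume "l \<in> {..<c}"
        then have "cmod (v $ l) \<le> 1"
          using norm_index_le_l2_norm[of l v] v by auto
        then show "cmod (A $$ (k, l) * v $ l) \<le> cmod (A $$ (k, l))"
          by (simp add: norm_mult mult_left_le)
      qed
      finally show ?thesis .
    qed
    then show "y \<le> sqrt (\<Sum>k<r. (\<Sum>l<c. cmod (A $$ (k, l)))\<^sup>2)"
      unfolding v(1) l2_norm_eq using A by (auto intro!: sum_mono power_mono)
  qed
  moreover have "l2_norm (A *\<^sub>v unit_vec c j) \<in> ?X"
  proof -
    have "l2_norm (unit_vec c j :: complex vec) = sqrt (\<Sum>i<c. if i = j then 1 else 0)"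
      unfolding l2_norm_eq using j
      by (intro arg_cong[of _ _ sqrt] sum.cong) (auto simp: unit_vec_def)
    also have "\<dots> \<le> 1" by simp
    finally show ?thesis using A by auto
  qed
  ultimately have "l2_norm (A *\<^sub>v unit_vec c j) \<le> spectral_norm A"
    unfolding spectral_norm_def by (rule cSup_upper[rotated])
  moreover have "cmod ((A *\<^sub>v unit_vec c j) $ i) \<le> l2_norm (A *\<^sub>v unit_vec c j)"
    using A i by (intro norm_index_le_l2_norm) auto
  moreover have "(A *\<^sub>v unit_vec c j) $ i = A $$ (i, j)"
    using A i j by (simp add: scalar_prod_right_unit)
  ultimately show ?thesis by simp
qed

text \<open>An input below \<open>2 ^ n\<close> is the same basis index with all ancillas at zero,
  so the padded identity picks out column \<open>x\<close> of \<open>V\<close>.\<close>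

lemma approximates_diag:
  assumes V: "V \<in> carrier_mat (2 ^ b) (2 ^ b)" and U: "U \<in> carrier_mat (2 ^ n) (2 ^ n)"
    and nb: "n \<le> b" and x: "x < 2 ^ n" and app: "approximates n b \<epsilon> V U"
  shows "cmod (V $$ (x, x) - U $$ (x, x)) \<le> \<epsilon>"
proof -
  let ?A = "V * with_ancillas b (1\<^sub>m (2 ^ n)) - with_ancillas b U"
  have le: "(2::nat) ^ n \<le> 2 ^ b" using nb by (simp add: power_increasing)
  then have xb: "x < 2 ^ b" using x by linarith
  have W: "with_ancillas b (1\<^sub>m (2 ^ n)) \<in> carrier_mat (2 ^ b) (2 ^ n)"
    by (simp add: with_ancillas_def)
  have "with_ancillas b (1\<^sub>m (2 ^ n)) $$ (s, x) = (if s = x then 1 else 0)" if "s < 2 ^ b" for s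
    using that x by (auto simp: with_ancillas_def)
  then have "(V * with_ancillas b (1\<^sub>m (2 ^ n))) $$ (x, x)
    = (\<Sum>s<2 ^ b. V $$ (x, s) * (if s = x then 1 else 0))"
    using V W x xb by (simp add: scalar_prod_def atLeast0LessThan)
  also have "\<dots> = V $$ (x, x)"
    using xb by (simp add: if_distrib cong: if_cong)
  finally have "?A $$ (x, x) = V $$ (x, x) - U $$ (x, x)"
    using U x xb by (simp add: with_ancillas_def)
  moreover have "?A \<in> carrier_mat (2 ^ b) (2 ^ n)"
    using U by (auto simp: with_ancillas_def)
  ultimately show ?thesis
    using norm_entry_le_spectral_norm[of ?A "2 ^ b" "2 ^ n" x x] app xb x
    unfolding approximates_def by simp
qed

section \<open>The diagonal of the time evolution\<close>

text \<open>The eigenvalue of Pauli-Z on qubit \<open>j\<close> at the basis state \<open>x\<close>;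
  \<open>energy\<close> below is accordingly the eigenvalue of the Hamiltonian.\<close>

definition spin :: "nat \<Rightarrow> nat \<Rightarrow> real" where
  "spin x j = (if bit x j then - 1 else 1)"

definition pairs :: "nat \<Rightarrow> (nat \<times> nat) set" where
  "pairs n = {(j, k). j < k \<and> k < n}"

definition energy :: "nat \<Rightarrow> (nat \<Rightarrow> nat \<Rightarrow> real) \<Rightarrow> nat \<Rightarrow> real" where
  "energy n \<beta> x = (\<Sum>(j, k)\<in>pairs n. \<beta> j k * spin x j * spin x k)"

lemma finite_pairs: "finite (pairs n)"
  by (rule finite_subset[of _ "{..<n} \<times> {..<n}"]) (auto simp: pairs_def)

lemma card_pairs: "2 * card (pairs n) = n * (n - 1)"
proof (induction n)
  case (Suc n)
  have "pairs (Suc n) = pairs n \<union> (\<lambda>j. (j, n)) ` {..<n}"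
    by (auto simp: pairs_def)
  moreover have "pairs n \<inter> (\<lambda>j. (j, n)) ` {..<n} = {}"
    by (auto simp: pairs_def)
  ultimately have "card (pairs (Suc n)) = card (pairs n) + n"
    by (simp add: card_Un_disjoint finite_pairs card_image inj_on_def)
  then show ?case using Suc by (cases n) auto
qed (simp add: pairs_def)

lemma nat_eq_if_bits:
  fixes r c :: nat
  assumes "r < 2 ^ n" "c < 2 ^ n" "\<forall>l<n. bit r l = bit c l"
  shows "r = c"
proof -
  have "take_bit n r = take_bit n c"
    using assms(3) by (intro bit_eqI) (auto simp: bit_take_bit_iff)
  then show ?thesis using assms by (simp add: take_bit_nat_eq_self)
qed

lemma on_qubit_pauli_Z:
  assumes "j < n" "r < 2 ^ n" "c < 2 ^ n"
  shows "on_qubit n pauli_Z j $$ (r, c) = (if r = c then complex_of_real (spin r j) else 0)"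
proof (cases "r = c")
  case True
  then show ?thesis using assms by (simp add: on_qubit_def pauli_Z_def spin_def mat_of_rows_list_def)
next
  case False
  then have "\<not> ((\<forall>l<n. l \<noteq> j \<longrightarrow> bit r l = bit c l) \<and> bit r j = bit c j)"
    using nat_eq_if_bits[of r n c] assms by blast
  then show ?thesis using assms False
    by (auto simp: on_qubit_def pauli_Z_def mat_of_rows_list_def)
qed

lemma zz_hamiltonian_index:
  assumes "r < 2 ^ n" "c < 2 ^ n"
  shows "zz_hamiltonian n \<beta> $$ (r, c) = (if r = c then complex_of_real (energy n \<beta> r) else 0)"
proof -
  have entry: "(on_qubit n pauli_Z j * on_qubit n pauli_Z k) $$ (r, c)
      = (if r = c then complex_of_real (spin r j * spin r k) else 0)"
    if "j < k" "k < n" for j k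
  proof -
    have "(on_qubit n pauli_Z j * on_qubit n pauli_Z k) $$ (r, c)
      = (\<Sum>s<2 ^ n. on_qubit n pauli_Z j $$ (r, s) * on_qubit n pauli_Z k $$ (s, c))"
      using assms by (simp add: on_qubit_def scalar_prod_def atLeast0LessThan)
    also have "\<dots> = (\<Sum>s<2 ^ n. if s = r then
      (if r = c then complex_of_real (spin r j * spin r k) else 0) else 0)"
      using assms that by (intro sum.cong) (auto simp: on_qubit_pauli_Z)
    also have "\<dots> = (if r = c then complex_of_real (spin r j * spin r k) else 0)"
      using assms by simp
    finally show ?thesis .
  qed
  have dims: "dim_row (on_qubit n A j) = 2 ^ n" "dim_col (on_qubit n A j) = 2 ^ n" for A j
    by (auto simp: on_qubit_def)
  have "zz_hamiltonian n \<beta> $$ (r, c) = (\<Sum>(j, k)\<in>pairs n.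
    if r = c then complex_of_real (\<beta> j k * spin r j * spin r k) else 0)"
    unfolding zz_hamiltonian_def mat_sum_def pairs_def[symmetric] using assms
    by (auto simp: entry dims pairs_def simp del: index_mult_mat(1) intro!: sum.cong)
  then show ?thesis
    by (auto simp: energy_def case_prod_unfold)
qed

lemma pow_mat_diag:
  assumes A: "A \<in> carrier_mat d d" and diag: "\<And>r c. r < d \<Longrightarrow> c < d \<Longrightarrow> r \<noteq> c \<Longrightarrow> A $$ (r, c) = 0"
    and "r < d" "c < d"
  shows "(A ^\<^sub>m m) $$ (r, c) = (if r = c then (A $$ (r, r)) ^ m else 0)"
  using assms(3,4)
proof (induction m arbitrary: r c)
  case (Suc m)
  have "(A ^\<^sub>m Suc m) $$ (r, c) = (\<Sum>s<d. (A ^\<^sub>m m) $$ (r, s) * A $$ (s, c))"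
    using A Suc.prems by (simp add: scalar_prod_def atLeast0LessThan)
  also have "\<dots> = (\<Sum>s<d. if s = r then (A $$ (r, r)) ^ m * A $$ (r, c) else 0)"
    using Suc by (intro sum.cong) auto
  also have "\<dots> = (A $$ (r, r)) ^ m * A $$ (r, c)"
    using Suc.prems by simp
  finally show ?case
    using diag[OF Suc.prems] by (cases "r = c") (simp_all only: power_Suc2, simp_all)
qed (use A in auto)

lemma mat_exp_zz_hamiltonian_diag:
  assumes x: "x < 2 ^ n"
  shows "mat_exp (- \<i> \<cdot>\<^sub>m zz_hamiltonian n \<beta>) $$ (x, x) = cis (- energy n \<beta> x)"
proof -
  let ?A = "- \<i> \<cdot>\<^sub>m zz_hamiltonian n \<beta>"
  have H: "zz_hamiltonian n \<beta> \<in> carrier_mat (2 ^ n) (2 ^ n)"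
    by (simp add: zz_hamiltonian_def mat_sum_def)
  then have A: "?A \<in> carrier_mat (2 ^ n) (2 ^ n)" by simp
  have "(?A ^\<^sub>m m) $$ (x, x) = (- \<i> * energy n \<beta> x) ^ m" for m
    using H x by (subst pow_mat_diag[OF A]) (auto simp: zz_hamiltonian_index)
  then have "mat_exp ?A $$ (x, x) = (\<Sum>m. (- \<i> * energy n \<beta> x) ^ m / of_nat (fact m))"
    using x H by (simp add: mat_exp_def)
  also have "\<dots> = exp (- \<i> * energy n \<beta> x)"
    unfolding exp_def by (simp add: scaleR_conv_of_real field_simps)
  also have "\<dots> = cis (- energy n \<beta> x)"
    by (simp add: cis_conv_exp)
  finally show ?thesis .
qed

lemma mat_exp_zz_hamiltonian_carrier:
  "mat_exp (a \<cdot>\<^sub>m zz_hamiltonian n \<beta>) \<in> carrier_mat (2 ^ n) (2 ^ n)"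
  by (simp add: mat_exp_def zz_hamiltonian_def mat_sum_def)

section \<open>The second difference of the energy\<close>

lemma bit_exp_add_exp:
  fixes j k l :: nat
  assumes "j \<noteq> k"
  shows "bit (2 ^ j + 2 ^ k :: nat) l \<longleftrightarrow> l = j \<or> l = k"
proof -
  have "(2 ^ j + 2 ^ k :: nat) = or (2 ^ j) (2 ^ k)"
    using assms by (intro disjunctive_add_eq_or bit_eqI) (auto simp: bit_and_iff bit_exp_iff)
  then show ?thesis by (auto simp: bit_or_iff bit_exp_iff)
qed

text \<open>A pair disjoint from the flipped qubits has the coefficient
  \<open>1 + 1 - 1 - 1\<close>, a pair containing just one of them two terms of each sign again, and
  the pair \<open>(j, k)\<close> itself \<open>1 + 1 + 1 + 1\<close>.\<close>

lemma energy_second_difference: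
  assumes "j < k" "k < n"
  shows "energy n \<beta> 0 + energy n \<beta> (2 ^ j + 2 ^ k) - energy n \<beta> (2 ^ j) - energy n \<beta> (2 ^ k)
    = 4 * \<beta> j k"
proof -
  have "energy n \<beta> 0 + energy n \<beta> (2 ^ j + 2 ^ k) - energy n \<beta> (2 ^ j) - energy n \<beta> (2 ^ k)
    = (\<Sum>(l, m)\<in>pairs n. \<beta> l m * (1 + spin (2 ^ j + 2 ^ k) l * spin (2 ^ j + 2 ^ k) m
        - spin (2 ^ j) l * spin (2 ^ j) m - spin (2 ^ k) l * spin (2 ^ k) m))"
    unfolding energy_def
    by (simp add: spin_def case_prod_unfold algebra_simps sum.distrib sum_subtractf)
  also have "\<dots> = (\<Sum>p\<in>pairs n. if p = (j, k) then 4 * \<beta> j k else 0)"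
    using assms by (intro sum.cong) (auto simp: pairs_def spin_def bit_exp_add_exp bit_exp_iff split: if_splits)
  also have "\<dots> = 4 * \<beta> j k"
    using assms finite_pairs by (simp add: pairs_def)
  finally show ?thesis .
qed

section \<open>Circuits as polynomials in the gate entries\<close>

text \<open>
  A variable \<open>(i, r, c, s)\<close> stands for the entry \<open>(r, c)\<close> of the gate number \<open>i\<close>, counted from
  the end of the gate list, and for its complex conjugate if \<open>s\<close> holds.
\<close>

type_synonym gate_var = "nat \<times> nat \<times> nat \<times> bool"

definition gate_vars :: "nat \<Rightarrow> gate_var set" where
  "gate_vars g = {..<g} \<times> {..<4} \<times> {..<4} \<times> UNIV"

definition flip :: "gate_var \<Rightarrow> gate_var" where
  "flip = (\<lambda>(i, r, c, s). (i, r, c, \<not> s))"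

definition gate_of :: "(gate_var \<Rightarrow> complex) \<Rightarrow> nat \<Rightarrow> complex mat" where
  "gate_of z i = mat 4 4 (\<lambda>(r, c). z (i, r, c, False))"

text \<open>The wiring is fixed and the gates vary. Numbering from the end gives the head gate the
  number \<open>length w\<close> and leaves the numbers of the other gates unchanged in the
  recursion.\<close>

fun wired_circuit :: "nat \<Rightarrow> (nat \<times> nat) list \<Rightarrow> (gate_var \<Rightarrow> complex) \<Rightarrow> complex mat" where
  "wired_circuit b [] z = 1\<^sub>m (2 ^ b)"
| "wired_circuit b ((j, k) # w) z = on_qubits b (gate_of z (length w)) j k * wired_circuit b w z"

definition gate_entries :: "(complex mat \<times> nat \<times> nat) list \<Rightarrow> gate_var \<Rightarrow> complex" where
  "gate_entries gs = (\<lambda>(i, r, c, s).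
     let x = fst (rev gs ! i) $$ (r, c) in if s then cnj x else x)"

lemma finite_gate_vars: "finite (gate_vars g)"
  by (simp add: gate_vars_def)

lemma card_gate_vars: "card (gate_vars g) = 32 * g"
  by (simp add: gate_vars_def card_cartesian_product)

lemma flip_flip [simp]: "flip (flip i) = i"
  by (auto simp: flip_def split: prod.splits)

lemma bij_betw_flip: "bij_betw flip (gate_vars g) (gate_vars g)"
  by (rule bij_betwI[of _ _ _ flip]) (auto simp: flip_def gate_vars_def)

lemma gate_entries_flip: "gate_entries gs (flip i) = cnj (gate_entries gs i)"
  by (auto simp: gate_entries_def flip_def Let_def split: prod.splits)

lemma on_qubits_carrier: "on_qubits b A j k \<in> carrier_mat (2 ^ b) (2 ^ b)"
  by (simp add: on_qubits_def)

lemma wired_circuit_carrier: "wired_circuit b w z \<in> carrier_mat (2 ^ b) (2 ^ b)"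
  by (induction w) (auto intro!: mult_carrier_mat[OF on_qubits_carrier])

lemma wired_circuit_Cons_index:
  assumes "r < 2 ^ b" "c < 2 ^ b"
  shows "wired_circuit b ((j, k) # w) z $$ (r, c)
    = (\<Sum>s<2 ^ b. on_qubits b (gate_of z (length w)) j k $$ (r, s) * wired_circuit b w z $$ (s, c))"
  using assms wired_circuit_carrier[of b w z] on_qubits_carrier[of b "gate_of z (length w)" j k]
  by (simp add: scalar_prod_def atLeast0LessThan)

definition pair_index :: "nat \<Rightarrow> nat \<Rightarrow> nat \<Rightarrow> nat" where
  "pair_index j k x = 2 * of_bool (bit x j) + of_bool (bit x k)"

definition agree_off :: "nat \<Rightarrow> nat \<Rightarrow> nat \<Rightarrow> nat \<Rightarrow> nat \<Rightarrow> bool" where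
  "agree_off b j k r c \<longleftrightarrow> (\<forall>l<b. l \<noteq> j \<and> l \<noteq> k \<longrightarrow> bit r l = bit c l)"

lemma pair_index_less: "pair_index j k x < 4"
  by (simp add: pair_index_def)

lemma on_qubits_index:
  assumes "r < 2 ^ b" "c < 2 ^ b"
  shows "on_qubits b A j k $$ (r, c)
    = (if agree_off b j k r c
       then A $$ (pair_index j k r, pair_index j k c) else 0)"
  using assms unfolding on_qubits_def pair_index_def agree_off_def by simp

lemma on_qubits_gate_of_index:
  assumes "r < 2 ^ b" "c < 2 ^ b"
  shows "on_qubits b (gate_of z i) j k $$ (r, c)
    = (if agree_off b j k r c
       then z (i, pair_index j k r, pair_index j k c, False) else 0)"
  using assms pair_index_less by (simp add: on_qubits_index gate_of_def)

text \<open>An entry is built from 0, 1 and gate variables by sums and products, so conjugation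
  passes to the variables.\<close>

lemma cnj_wired_circuit:
  assumes "r < 2 ^ b" "c < 2 ^ b"
  shows "cnj (wired_circuit b w z $$ (r, c)) = wired_circuit b w (\<lambda>i. cnj (z i)) $$ (r, c)"
  using assms
proof (induction w arbitrary: r c)
  case (Cons p w)
  obtain j k where p: "p = (j, k)" by force
  have "cnj (on_qubits b (gate_of z (length w)) j k $$ (r, s))
      = on_qubits b (gate_of (\<lambda>i. cnj (z i)) (length w)) j k $$ (r, s)" if "s < 2 ^ b" for s
    using Cons.prems that by (simp add: on_qubits_gate_of_index)
  then show ?case using Cons unfolding p
    by (simp add: wired_circuit_Cons_index del: wired_circuit.simps)
qed auto

text \<open>Each gate occurs in just one factor of the product, so an entry has degree at most 1 in
  each plain variable and degree 0 in the conjugate ones.\<close>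

lemma wired_circuit_polys:
  assumes "length w \<le> g" "r < 2 ^ b" "c < 2 ^ b"
  shows "(\<lambda>z. wired_circuit b w z $$ (r, c))
    \<in> polys (gate_vars g) (\<lambda>(i, _, _, s). of_bool (i < length w \<and> \<not> s))"
  using assms
proof (induction w arbitrary: r c)
  case Nil
  then show ?case using polys_const[OF finite_gate_vars] by simp
next
  case (Cons p w)
  obtain j k where p: "p = (j, k)" by force
  let ?D = "\<lambda>(i, _, _, s). of_bool (i = length w \<and> \<not> s) :: nat"
  let ?D' = "\<lambda>(i, _, _, s). of_bool (i < length w \<and> \<not> s) :: nat"
  have "(\<lambda>z. z (length w, pair_index j k x, pair_index j k y, False)) \<in> polys (gate_vars g) ?D"
    for x y
    using Cons.prems pair_index_less
    by (intro polys_var[OF finite_gate_vars]) (auto simp: gate_vars_def)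
  then have "(\<lambda>z. on_qubits b (gate_of z (length w)) j k $$ (r, s)) \<in> polys (gate_vars g) ?D"
    if "s < 2 ^ b" for s
    using Cons.prems that polys_zero[OF finite_gate_vars]
    by (cases "agree_off b j k r s") (simp_all add: on_qubits_gate_of_index)
  then have "(\<lambda>z. \<Sum>s<2 ^ b. on_qubits b (gate_of z (length w)) j k $$ (r, s)
      * wired_circuit b w z $$ (s, c)) \<in> polys (gate_vars g) (\<lambda>i. ?D i + ?D' i)"
    using Cons by (intro polys_sum polys_mult finite_gate_vars) auto
  then show ?case
    using Cons.prems unfolding p
    by (subst wired_circuit_Cons_index)
      (auto elim!: polys_mono[OF finite_gate_vars])
qed

text \<open>\<open>z\<close> only has to agree with the gates present, so that the induction can
  keep it for the shorter list.\<close>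

lemma foldr_eq_wired_circuit:
  assumes "\<And>i r c. i < length gs \<Longrightarrow> r < 4 \<Longrightarrow> c < 4 \<Longrightarrow> z (i, r, c, False) = fst (rev gs ! i) $$ (r, c)"
  shows "foldr (\<lambda>(G, j, k) M. on_qubits b G j k * M) gs (1\<^sub>m (2 ^ b)) = wired_circuit b (map snd gs) z"
  using assms
proof (induction gs)
  case (Cons x gs)
  obtain G j k where x: "x = (G, j, k)" by (cases x)
  have "z (i, r, c, False) = fst (rev gs ! i) $$ (r, c)" if "i < length gs" "r < 4" "c < 4" for i r c
    using Cons.prems[of i r c] that by (simp add: nth_append)
  note IH = Cons.IH[OF this]
  have "on_qubits b G j k = on_qubits b (gate_of z (length gs)) j k"
    using Cons.prems[of "length gs"] pair_index_less on_qubits_carrier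
    by (intro eq_matI) (auto simp: x on_qubits_index gate_of_def nth_append on_qubits_def)
  then show ?case using IH by (simp add: x)
qed simp

lemma foldr_eq_wired_circuit_gate_entries:
  "foldr (\<lambda>(G, j, k) M. on_qubits b G j k * M) gs (1\<^sub>m (2 ^ b))
    = wired_circuit b (map snd gs) (gate_entries gs)"
  by (rule foldr_eq_wired_circuit) (simp add: gate_entries_def)

text \<open>For the exact time evolution the four phases combine to the negative second difference
  of the energy, so the value is \<open>cis (- 4 * \<beta> j k)\<close>.\<close>

definition correlator :: "complex mat \<Rightarrow> nat \<times> nat \<Rightarrow> complex" where
  "correlator V = (\<lambda>(j, k). V $$ (0, 0) * V $$ (2 ^ j + 2 ^ k, 2 ^ j + 2 ^ k)
     * (cnj (V $$ (2 ^ j, 2 ^ j)) * cnj (V $$ (2 ^ k, 2 ^ k))))"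

lemma exp_sum_less: "j < k \<Longrightarrow> k < n \<Longrightarrow> (2::nat) ^ j + 2 ^ k < 2 ^ n"
proof -
  assume "j < k" "k < n"
  then have "(2::nat) ^ j < 2 ^ k" by simp
  moreover have "(2::nat) ^ Suc k \<le> 2 ^ n"
    by (rule power_increasing) (use \<open>k < n\<close> in auto)
  ultimately show ?thesis unfolding power_Suc by linarith
qed

text \<open>The imaginary part of \<open>Q\<close> is \<open>(Q - cnj Q) / (2 * \<i>)\<close>, and
  flipping the variables turns \<open>Q\<close> into \<open>cnj Q\<close> at the points considered.
  Two plain and two conjugated entries give degree 2. \<open>\<alpha>\<close> and
  \<open>\<kappa>\<close> allow a later rescaling.\<close>

lemma Im_correlator_polys:
  assumes w: "length w \<le> g" and p: "p \<in> pairs b"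
  shows "\<exists>F \<in> polys (gate_vars g) (\<lambda>_. 2). \<forall>z. (\<forall>i. z (flip i) = cnj (z i)) \<longrightarrow>
    F z = complex_of_real (\<alpha> + \<kappa> * Im (correlator (wired_circuit b w z) p))"
proof -
  obtain j k where jk: "p = (j, k)" "j < k" "k < b" using p by (auto simp: pairs_def)
  let ?I = "gate_vars g"
  let ?v = "\<lambda>x z. wired_circuit b w z $$ (x, x)"
  let ?c = "\<lambda>x z. ?v x (\<lambda>i. z (flip i))"
  let ?D = "\<lambda>(i, _, _, s). of_bool (i < length w \<and> \<not> s) :: nat"
  let ?jk = "2 ^ j + 2 ^ k :: nat"
  have bounds: "(0::nat) < 2 ^ b" "?jk < 2 ^ b" "(2::nat) ^ j < 2 ^ b" "(2::nat) ^ k < 2 ^ b"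
    using exp_sum_less[OF jk(2,3)] jk by auto
  note I = finite_gate_vars[of g]
  have v: "?v x \<in> polys ?I ?D" if "x < 2 ^ b" for x
    using wired_circuit_polys[OF w that that] .
  have c: "?c x \<in> polys ?I (\<lambda>i. ?D (flip i))" if "x < 2 ^ b" for x
    by (rule polys_reindex[OF I bij_betw_flip _ v[OF that]]) simp
  define Q where "Q = (\<lambda>z. ?v 0 z * ?v ?jk z * (?c (2 ^ j) z * ?c (2 ^ k) z))"
  have Q': "Q \<in> polys ?I (\<lambda>i. ?D i + ?D i + (?D (flip i) + ?D (flip i)))"
    unfolding Q_def
    by (rule polys_mult[OF I polys_mult[OF I v v] polys_mult[OF I c c]]) (rule bounds)+
  have Q: "Q \<in> polys ?I (\<lambda>_. 2)"
    by (rule polys_mono[OF I Q']) (auto simp: flip_def split: prod.splits)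
  have Qf: "(\<lambda>z. Q (\<lambda>i. z (flip i))) \<in> polys ?I (\<lambda>_. 2)"
    using polys_reindex[OF I bij_betw_flip _ Q] by simp
  let ?F = "\<lambda>z. complex_of_real \<alpha> + ((- \<i> * \<kappa> / 2) * Q z + (\<i> * \<kappa> / 2) * Q (\<lambda>i. z (flip i)))"
  have "?F \<in> polys ?I (\<lambda>_. 2)"
    by (rule polys_add[OF I polys_const[OF I] polys_add[OF I polys_scale[OF I Q] polys_scale[OF I Qf]]])
  moreover have "?F z = complex_of_real (\<alpha> + \<kappa> * Im (correlator (wired_circuit b w z) p))"
    if z: "\<forall>i. z (flip i) = cnj (z i)" for z
  proof -
    have z': "(\<lambda>i. z (flip i)) = (\<lambda>i. cnj (z i))" using z by auto
    have cnj: "?c x z = cnj (?v x z)" if "x < 2 ^ b" for x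
      unfolding z' using cnj_wired_circuit[OF that that, of w z] by simp
    have "Q z = correlator (wired_circuit b w z) p"
      using cnj bounds by (simp add: Q_def correlator_def jk)
    moreover have "Q (\<lambda>i. z (flip i)) = cnj (correlator (wired_circuit b w z) p)"
      using cnj bounds by (simp add: Q_def correlator_def jk)
    ultimately show ?thesis by (simp add: complex_eq_iff)
  qed
  ultimately show ?thesis by (intro bexI[of _ ?F] allI impI)
qed

section \<open>Decoding the signs of the couplings\<close>

lemma sin_ge_cubic:
  fixes x :: real
  assumes "0 \<le> x"
  shows "x - x ^ 3 / 6 \<le> sin x"
proof -
  have "(\<Sum>m<3. sin_coeff m * x ^ m) = x"
    by (simp add: lessThan_nat_numeral sin_coeff_def)
  then have "\<bar>sin x - x\<bar> \<le> x ^ 3 / 6"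
    using Maclaurin_sin_bound[of x 3] assms by (simp add: fact_numeral)
  then show ?thesis by linarith
qed

text \<open>By the double angle formula it suffices that the sine of 3/4 is below the square root of
  1/2; a Taylor estimate gives 7/10.\<close>

lemma cos_three_halves_pos: "cos (3 / 2 :: real) > 0"
proof -
  have "(\<Sum>m<5. sin_coeff m * (3 / 4 :: real) ^ m) = 3 / 4 - (3 / 4) ^ 3 / 6"
    by (simp add: lessThan_nat_numeral sin_coeff_def fact_numeral)
  then have "\<bar>sin (3 / 4 :: real) - (3 / 4 - (3 / 4) ^ 3 / 6)\<bar> \<le> (3 / 4) ^ 5 / 120"
    using Maclaurin_sin_bound[of "3 / 4" 5] by (simp add: fact_numeral)
  then have "sin (3 / 4 :: real) \<le> (3 / 4 - (3 / 4) ^ 3 / 6) + (3 / 4) ^ 5 / 120"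
    by linarith
  also have "\<dots> \<le> (7 / 10 :: real)" by (simp add: power_divide)
  finally have "sin (3 / 4 :: real) \<le> 7 / 10" .
  moreover have "0 \<le> sin (3 / 4 :: real)" using pi_ge_two by (intro sin_ge_zero) auto
  ultimately have "(sin (3 / 4 :: real))\<^sup>2 \<le> (7 / 10)\<^sup>2" by (intro power_mono)
  then show ?thesis
    using cos_double_sin[of "3 / 4 :: real"] by (simp add: power2_eq_square)
qed

text \<open>The slope 21/20 suffices since the cubic loss
  \<open>(21/20 * \<epsilon>) ^ 3 / 6\<close> is at most \<open>\<epsilon> / 20\<close>. Four such
  phase errors stay below \<open>24/5 * \<epsilon>\<close>.\<close>

lemma arcsin_le_linear:
  fixes \<epsilon> :: real
  assumes "0 \<le> \<epsilon>" "\<epsilon> < 1 / 3"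
  shows "arcsin \<epsilon> \<le> 21 / 20 * \<epsilon>"
proof -
  have "\<epsilon> * \<epsilon>\<^sup>2 \<le> \<epsilon> * (1 / 9)"
    using assms power_mono[of \<epsilon> "1 / 3" 2] by (intro mult_left_mono) (auto simp: power2_eq_square)
  moreover have "(21 / 20 * \<epsilon>) ^ 3 = 9261 / 8000 * (\<epsilon> * \<epsilon>\<^sup>2)"
    by (simp add: power3_eq_cube power2_eq_square)
  ultimately have "\<epsilon> \<le> 21 / 20 * \<epsilon> - (21 / 20 * \<epsilon>) ^ 3 / 6"
    using assms by simp
  also have "\<dots> \<le> sin (21 / 20 * \<epsilon>)"
    using assms by (intro sin_ge_cubic) auto
  finally have "arcsin \<epsilon> \<le> arcsin (sin (21 / 20 * \<epsilon>))"
    using assms by (intro arcsin_le_arcsin) auto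
  also have "\<dots> = 21 / 20 * \<epsilon>"
    using assms pi_ge_two by (intro arcsin_sin) auto
  finally show ?thesis .
qed

text \<open>Seen from the origin, a disc of radius \<open>\<epsilon>\<close> around a point of the
  unit circle extends by an angle of at most \<open>arcsin \<epsilon>\<close> to either side of this
  point.\<close>

lemma near_cis_polar:
  assumes \<epsilon>: "\<epsilon> < 1 / 3" and v: "cmod (v - cis \<theta>) \<le> \<epsilon>"
  obtains \<rho> \<psi> where "v = rcis \<rho> (\<theta> + \<psi>)" "2 / 3 \<le> \<rho>" "\<rho> \<le> 4 / 3" "\<bar>\<psi>\<bar> \<le> 21 / 20 * \<epsilon>"
proof -
  define u where "u = v * cis (- \<theta>)"
  define s where "s = Im u / cmod u"
  have \<epsilon>0: "0 \<le> \<epsilon>" using v norm_ge_zero order_trans by blast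
  have "u - 1 = (v - cis \<theta>) * cis (- \<theta>)"
    by (simp add: u_def algebra_simps cis_mult)
  then have u1: "cmod (u - 1) \<le> \<epsilon>" using v by (simp add: norm_mult)
  have \<rho>: "1 - \<epsilon> \<le> cmod u" "cmod u \<le> 1 + \<epsilon>"
    using u1 norm_triangle_ineq2[of 1 u] norm_triangle_ineq2[of u 1]
    by (auto simp: norm_minus_commute)
  then have pos: "cmod u > 0" using \<epsilon> by linarith
  have "\<bar>Re (u - 1)\<bar> \<le> \<epsilon>" using abs_Re_le_cmod u1 order_trans by blast
  then have Re: "Re u > 0" using \<epsilon> by auto
  have "(Re u - 1)\<^sup>2 + (Im u)\<^sup>2 \<le> \<epsilon>\<^sup>2"
    using power_mono[OF u1, of 2] by (simp add: cmod_power2)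
  \<comment> \<open>Multiplying by \<open>1 - \<epsilon>\<^sup>2\<close> and completing the square
    gives the tangent bound: the sine of the phase of \<open>u\<close> is at most
    \<open>\<epsilon>\<close> in absolute value.\<close>
  then have "(1 - \<epsilon>\<^sup>2) * (Im u)\<^sup>2 \<le> (1 - \<epsilon>\<^sup>2) * (\<epsilon>\<^sup>2 - (Re u - 1)\<^sup>2)"
    using \<epsilon> \<epsilon>0 by (intro mult_left_mono) (auto simp: power_le_one)
  also have "\<dots> = \<epsilon>\<^sup>2 * (Re u)\<^sup>2 - (Re u - (1 - \<epsilon>\<^sup>2))\<^sup>2"
    by (simp add: power2_eq_square algebra_simps)
  also have "\<dots> \<le> \<epsilon>\<^sup>2 * (Re u)\<^sup>2" by simp
  finally have "(Im u)\<^sup>2 \<le> (\<epsilon> * cmod u)\<^sup>2"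
    by (simp add: power_mult_distrib cmod_power2 algebra_simps)
  then have "\<bar>Im u\<bar> \<le> \<epsilon> * cmod u"
    using \<epsilon>0 by (metis abs_le_square_iff abs_of_nonneg mult_nonneg_nonneg norm_ge_zero)
  then have s: "\<bar>s\<bar> \<le> \<epsilon>" using pos by (simp add: s_def divide_le_eq)
  have "(Re u / cmod u)\<^sup>2 + s\<^sup>2 = ((Re u)\<^sup>2 + (Im u)\<^sup>2) / (cmod u)\<^sup>2"
    by (simp add: s_def power_divide add_divide_distrib)
  also have "\<dots> = 1" using pos by (simp add: cmod_power2[symmetric])
  finally have "1 - s\<^sup>2 = (Re u / cmod u)\<^sup>2" by simp
  then have cos: "cos (arcsin s) = Re u / cmod u"
    using s \<epsilon> Re pos by (simp add: cos_arcsin real_sqrt_unique)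
  have sin: "sin (arcsin s) = s" using s \<epsilon> by simp
  have u: "u = rcis (cmod u) (arcsin s)"
    using pos by (simp add: complex_eq_iff cos sin) (simp add: s_def)
  have "v = u * cis \<theta>" by (simp add: u_def mult.assoc cis_mult)
  also have "\<dots> = rcis (cmod u) (\<theta> + arcsin s)"
    by (subst u) (simp add: rcis_def cis_mult mult.assoc add.commute)
  finally have "v = rcis (cmod u) (\<theta> + arcsin s)" .
  moreover have "\<bar>arcsin s\<bar> \<le> 21 / 20 * \<epsilon>"
  proof -
    have "arcsin s \<le> arcsin \<epsilon>" "arcsin (- s) \<le> arcsin \<epsilon>"
      using s \<epsilon> by (auto intro!: arcsin_le_arcsin)
    then show ?thesis
      using arcsin_le_linear[OF \<epsilon>0 \<epsilon>] s \<epsilon> by (simp add: arcsin_minus)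
  qed
  ultimately show ?thesis using that[of "cmod u" "arcsin s"] \<rho> \<epsilon> by simp
qed

text \<open>Chosen below \<open>(2/3) ^ 4 * (3/8 * cos (3/2))\<close>, the least modulus of a
  correlator times the least ratio of the sine of its phase to \<open>\<epsilon>\<close>.\<close>

definition margin :: real where
  "margin = cos (3 / 2) / 20"

lemma margin_pos: "0 < margin"
  unfolding margin_def using cos_three_halves_pos by simp

text \<open>Halve the angle: as \<open>x / 2 \<le> 3 / 2\<close>, the cubic bound leaves the factor
  \<open>1 - (3/2)\<^sup>2 / 6 = 5/8\<close> for the sine, and the cosine is at least
  \<open>cos (3/2)\<close>.\<close>

lemma sin_ge_linear:
  fixes x :: real
  assumes "0 \<le> x" "x \<le> 3"
  shows "5 / 8 * cos (3 / 2) * x \<le> sin x"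
proof -
  have "x / 2 * (x / 2)\<^sup>2 \<le> x / 2 * (9 / 4)"
    using assms power_mono[of "x / 2" "3 / 2" 2] by (intro mult_left_mono) (auto simp: power2_eq_square)
  then have "5 / 8 * (x / 2) \<le> x / 2 - (x / 2) ^ 3 / 6"
    by (simp add: power3_eq_cube power2_eq_square)
  also have "\<dots> \<le> sin (x / 2)" using assms by (intro sin_ge_cubic) auto
  finally have s: "5 / 8 * (x / 2) \<le> sin (x / 2)" .
  have c: "cos (3 / 2) \<le> cos (x / 2)"
    using assms pi_ge_two by (intro cos_monotone_0_pi_le) auto
  have "5 / 8 * (x / 2) * cos (3 / 2) \<le> sin (x / 2) * cos (x / 2)"
    using margin_pos s c assms by (intro mult_mono) (auto simp: margin_def intro: order_trans[OF _ s])
  then show ?thesis using sin_double[of "x / 2"] by (simp add: mult_ac)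
qed

text \<open>The phase lies between \<open>(24/5 - 21/5) * \<epsilon> = 3/5 * \<epsilon>\<close> and
  \<open>9 * \<epsilon>\<close>, which is below 3. The constant 30 exceeds
  \<open>9 * (4/3) ^ 4\<close>.\<close>

lemma Im_rcis_bounds:
  assumes \<epsilon>: "0 < \<epsilon>" "\<epsilon> < 1 / 3" and R: "(2 / 3) ^ 4 \<le> R" "R \<le> (4 / 3) ^ 4"
    and \<psi>: "\<bar>\<psi>\<bar> \<le> 21 / 5 * \<epsilon>"
  shows "margin * \<epsilon> \<le> R * sin (24 / 5 * \<epsilon> + \<psi>)" "R * sin (24 / 5 * \<epsilon> + \<psi>) \<le> 30 * \<epsilon>"
proof -
  let ?x = "24 / 5 * \<epsilon> + \<psi>"
  have x: "3 / 5 * \<epsilon> \<le> ?x" "?x \<le> 9 * \<epsilon>" using \<psi> by auto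
  have c: "cos (3 / 2) > (0::real)" using margin_pos by (simp add: margin_def)
  have R0: "0 < R" using R(1) by (auto intro: less_le_trans[rotated])
  have "5 / 8 * cos (3 / 2) * (3 / 5 * \<epsilon>) \<le> 5 / 8 * cos (3 / 2) * ?x"
    using x c by (intro mult_left_mono) auto
  also have "\<dots> \<le> sin ?x" using x \<epsilon> by (intro sin_ge_linear) auto
  finally have s: "3 / 8 * cos (3 / 2) * \<epsilon> \<le> sin ?x" by (simp add: mult.commute mult.left_commute)
  have "margin * \<epsilon> \<le> (2 / 3) ^ 4 * (3 / 8 * cos (3 / 2) * \<epsilon>)"
    using c \<epsilon> by (simp add: margin_def power4_eq_xxxx)
  also have "\<dots> \<le> R * sin ?x"
    using R R0 s c \<epsilon> by (intro mult_mono) auto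
  finally show "margin * \<epsilon> \<le> R * sin ?x" .
  have "R * sin ?x \<le> (4 / 3) ^ 4 * (9 * \<epsilon>)"
  proof (intro mult_mono R)
    show "sin ?x \<le> 9 * \<epsilon>" using x \<epsilon> sin_x_le_x[of ?x] by linarith
    show "0 \<le> sin ?x" using order_trans[OF _ s, of 0] c \<epsilon> by simp
  qed auto
  also have "\<dots> \<le> 30 * \<epsilon>" using \<epsilon> by (simp add: power4_eq_xxxx)
  finally show "R * sin ?x \<le> 30 * \<epsilon>" .
qed

text \<open>
  The four diagonal entries in a correlator are off by phases of at most \<open>21/20 \<epsilon>\<close> each, in total
  \<open>21/5 \<epsilon>\<close>. A coupling of size \<open>6/5 \<epsilon>\<close> contributes the phase \<open>24/5 \<epsilon>\<close>, which outweighs this error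
  while the sum stays below \<open>9 \<epsilon> < 3\<close>, hence below \<open>\<pi>\<close>.
\<close>

definition signed_couplings :: "real \<Rightarrow> (nat \<times> nat) set \<Rightarrow> nat \<Rightarrow> nat \<Rightarrow> real" where
  "signed_couplings \<epsilon> a j k = (if (j, k) \<in> a then - (6 / 5 * \<epsilon>) else 6 / 5 * \<epsilon>)"

text \<open>Couplings enter the phase with the factor -4, so the negative ones, those in
  \<open>a\<close>, make the imaginary part positive. The lower bounds separate the signs; the upper
  bounds permit rescaling to the unit interval.\<close>

lemma correlator_decodes:
  assumes \<epsilon>: "0 < \<epsilon>" "\<epsilon> < 1 / 3" and nb: "n \<le> b" and V: "V \<in> carrier_mat (2 ^ b) (2 ^ b)"
    and app: "approximates n b \<epsilon> V (mat_exp (- \<i> \<cdot>\<^sub>m zz_hamiltonian n (signed_couplings \<epsilon> a)))"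
    and p: "p \<in> pairs n"
  shows "p \<in> a \<Longrightarrow> margin * \<epsilon> \<le> Im (correlator V p) \<and> Im (correlator V p) \<le> 30 * \<epsilon>"
    and "p \<notin> a \<Longrightarrow> margin * \<epsilon> \<le> - Im (correlator V p) \<and> - Im (correlator V p) \<le> 30 * \<epsilon>"
proof -
  obtain j k where jk: "p = (j, k)" "j < k" "k < n" using p by (auto simp: pairs_def)
  let ?\<beta> = "signed_couplings \<epsilon> a"
  let ?E = "energy n ?\<beta>" and ?v = "\<lambda>x. V $$ (x, x)"
  have near: "cmod (?v x - cis (- ?E x)) \<le> \<epsilon>" if "x < 2 ^ n" for x
    using approximates_diag[OF V mat_exp_zz_hamiltonian_carrier nb that app]
    by (simp add: mat_exp_zz_hamiltonian_diag that)
  note polar = near_cis_polar[OF \<epsilon>(2) near]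
  have bounds: "(0::nat) < 2 ^ n" "(2::nat) ^ j + 2 ^ k < 2 ^ n" "(2::nat) ^ j < 2 ^ n" "(2::nat) ^ k < 2 ^ n"
    using exp_sum_less[OF jk(2,3)] jk by auto
  obtain r0 s0 where 0: "?v 0 = rcis r0 (- ?E 0 + s0)" "2 / 3 \<le> r0" "r0 \<le> 4 / 3" "\<bar>s0\<bar> \<le> 21 / 20 * \<epsilon>"
    by (rule polar[OF bounds(1)])
  obtain r1 s1 where 1: "?v (2 ^ j + 2 ^ k) = rcis r1 (- ?E (2 ^ j + 2 ^ k) + s1)"
    "2 / 3 \<le> r1" "r1 \<le> 4 / 3" "\<bar>s1\<bar> \<le> 21 / 20 * \<epsilon>"
    by (rule polar[OF bounds(2)])
  obtain r2 s2 where 2: "?v (2 ^ j) = rcis r2 (- ?E (2 ^ j) + s2)"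
    "2 / 3 \<le> r2" "r2 \<le> 4 / 3" "\<bar>s2\<bar> \<le> 21 / 20 * \<epsilon>"
    by (rule polar[OF bounds(3)])
  obtain r3 s3 where 3: "?v (2 ^ k) = rcis r3 (- ?E (2 ^ k) + s3)"
    "2 / 3 \<le> r3" "r3 \<le> 4 / 3" "\<bar>s3\<bar> \<le> 21 / 20 * \<epsilon>"
    by (rule polar[OF bounds(4)])
  \<comment> \<open>The moduli multiply, and the phase errors of the two conjugated entries enter
    negatively.\<close>
  define R where "R = r0 * r1 * (r2 * r3)"
  define \<psi> where "\<psi> = s0 + s1 - s2 - s3"
  have cnj: "cnj (rcis r x) = rcis r (- x)" for r x by (simp add: complex_eq_iff)
  have E: "?E 0 + ?E (2 ^ j + 2 ^ k) - ?E (2 ^ j) - ?E (2 ^ k) = 4 * ?\<beta> j k"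
    by (rule energy_second_difference[OF jk(2,3)])
  have "correlator V p = rcis R (- ?E 0 + s0 + (- ?E (2 ^ j + 2 ^ k) + s1)
      + (- (- ?E (2 ^ j) + s2) + - (- ?E (2 ^ k) + s3)))"
    unfolding correlator_def jk prod.case 0(1) 1(1) 2(1) 3(1) cnj rcis_mult R_def ..
  also have "\<dots> = rcis R (\<psi> - 4 * ?\<beta> j k)"
    unfolding E[symmetric] \<psi>_def by (simp add: algebra_simps)
  finally have Im: "Im (correlator V p) = R * sin (\<psi> - 4 * ?\<beta> j k)" by simp
  have "(2 / 3 * (2 / 3)) * (2 / 3 * (2 / 3)) \<le> R" unfolding R_def
    using 0 1 2 3 by (intro mult_mono mult_nonneg_nonneg) auto
  then have R1: "(2 / 3) ^ 4 \<le> R" by (simp add: power4_eq_xxxx)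
  have "R \<le> (4 / 3 * (4 / 3)) * (4 / 3 * (4 / 3))" unfolding R_def
    using 0 1 2 3 by (intro mult_mono mult_nonneg_nonneg) auto
  then have R2: "R \<le> (4 / 3) ^ 4" by (simp add: power4_eq_xxxx)
  have \<psi>: "\<bar>\<psi>\<bar> \<le> 21 / 5 * \<epsilon>" "\<bar>- \<psi>\<bar> \<le> 21 / 5 * \<epsilon>" unfolding \<psi>_def using 0 1 2 3 by linarith+
  note bounds' = Im_rcis_bounds[OF \<epsilon> R1 R2]
  show "margin * \<epsilon> \<le> Im (correlator V p) \<and> Im (correlator V p) \<le> 30 * \<epsilon>" if "p \<in> a"
  proof -
    have "\<psi> - 4 * ?\<beta> j k = 24 / 5 * \<epsilon> + \<psi>"
      using that by (simp add: signed_couplings_def jk)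
    then show ?thesis using bounds'[OF \<psi>(1)] unfolding Im by (simp only:)
  qed
  show "margin * \<epsilon> \<le> - Im (correlator V p) \<and> - Im (correlator V p) \<le> 30 * \<epsilon>" if "p \<notin> a"
  proof -
    have "\<psi> - 4 * ?\<beta> j k = - (24 / 5 * \<epsilon> + - \<psi>)"
      using that by (simp add: signed_couplings_def jk)
    then have "- Im (correlator V p) = R * sin (24 / 5 * \<epsilon> + - \<psi>)"
      unfolding Im by (simp only: sin_minus)
    then show ?thesis using bounds'[OF \<psi>(2)] by simp
  qed
qed

section \<open>Counting circuits\<close>

definition circuit_of :: "nat \<Rightarrow> (complex mat \<times> nat \<times> nat) list \<Rightarrow> complex mat" where
  "circuit_of b gs = foldr (\<lambda>(G, j, k) M. on_qubits b G j k * M) gs (1\<^sub>m (2 ^ b))"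

lemma circuit_of_carrier: "circuit_of b gs \<in> carrier_mat (2 ^ b) (2 ^ b)"
  unfolding circuit_of_def foldr_eq_wired_circuit_gate_entries by (rule wired_circuit_carrier)

text \<open>Fixes one gate list for each sign pattern \<open>a\<close> and passes from the
  approximation to the decoded imaginary parts, the form that both counts use.\<close>

lemma circuits_for_sign_patterns:
  assumes \<epsilon>: "0 < \<epsilon>" "\<epsilon> < 1 / 3" and t: "6 / 5 * \<epsilon> \<le> t" and nb: "n \<le> b"
    and g: "\<And>H. H \<in> zz_hamiltonians n t \<Longrightarrow>
      \<exists>V. is_circuit b K g V \<and> approximates n b \<epsilon> V (mat_exp ((- \<i>) \<cdot>\<^sub>m H))"
  obtains gs where
    "\<And>a. length (gs a) = g"
    "\<And>a. set (gs a) \<subseteq> K \<times> {..<b} \<times> {..<b}"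
    "\<And>a p. p \<in> pairs n \<Longrightarrow> p \<in> a \<Longrightarrow> margin * \<epsilon> \<le> Im (correlator (circuit_of b (gs a)) p)
      \<and> Im (correlator (circuit_of b (gs a)) p) \<le> 30 * \<epsilon>"
    "\<And>a p. p \<in> pairs n \<Longrightarrow> p \<notin> a \<Longrightarrow> margin * \<epsilon> \<le> - Im (correlator (circuit_of b (gs a)) p)
      \<and> - Im (correlator (circuit_of b (gs a)) p) \<le> 30 * \<epsilon>"
proof -
  have "\<exists>gs. length gs = g \<and> set gs \<subseteq> K \<times> {..<b} \<times> {..<b} \<and>
    approximates n b \<epsilon> (circuit_of b gs)
      (mat_exp (- \<i> \<cdot>\<^sub>m zz_hamiltonian n (signed_couplings \<epsilon> a)))" for a
  proof -
    have "zz_hamiltonian n (signed_couplings \<epsilon> a) \<in> zz_hamiltonians n t"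
      unfolding zz_hamiltonians_def using \<epsilon> t
      by (auto intro!: exI[of _ "signed_couplings \<epsilon> a"] simp: signed_couplings_def)
    from g[OF this] obtain V where V: "is_circuit b K g V"
      "approximates n b \<epsilon> V (mat_exp (- \<i> \<cdot>\<^sub>m zz_hamiltonian n (signed_couplings \<epsilon> a)))"
      by blast
    from V(1) obtain gs where gs: "length gs = g" "V = circuit_of b gs"
      "\<forall>(G, j, k) \<in> set gs. G \<in> K \<and> j < b \<and> k < b \<and> j \<noteq> k"
      unfolding is_circuit_def circuit_of_def by blast
    have "set gs \<subseteq> K \<times> {..<b} \<times> {..<b}" using gs(3) by fast
    then show ?thesis using gs(1,2) V(2) by blast
  qed
  then have "\<exists>gs. \<forall>a. length (gs a) = g \<and> set (gs a) \<subseteq> K \<times> {..<b} \<times> {..<b} \<and>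
    approximates n b \<epsilon> (circuit_of b (gs a))
      (mat_exp (- \<i> \<cdot>\<^sub>m zz_hamiltonian n (signed_couplings \<epsilon> a)))"
    by (intro choice allI)
  then obtain gs where gs: "\<And>a. length (gs a) = g" "\<And>a. set (gs a) \<subseteq> K \<times> {..<b} \<times> {..<b}"
    "\<And>a. approximates n b \<epsilon> (circuit_of b (gs a))
      (mat_exp (- \<i> \<cdot>\<^sub>m zz_hamiltonian n (signed_couplings \<epsilon> a)))"
    by blast
  show ?thesis
    by (rule that[of gs, OF gs(1,2)])
      (erule correlator_decodes[OF \<epsilon> nb circuit_of_carrier gs(3)], assumption)+
qed

text \<open>A sign pattern can be read off from its gate list, so the patterns inject into the lists
  of \<open>g\<close> placed gates.\<close>

lemma finite_gate_set_count:
  assumes \<epsilon>: "0 < \<epsilon>" "\<epsilon> < 1 / 3" and t: "6 / 5 * \<epsilon> \<le> t" and nb: "n \<le> b" and K: "finite K"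
    and g: "\<And>H. H \<in> zz_hamiltonians n t \<Longrightarrow>
      \<exists>V. is_circuit b K g V \<and> approximates n b \<epsilon> V (mat_exp ((- \<i>) \<cdot>\<^sub>m H))"
  shows "2 ^ card (pairs n) \<le> (b * card K) ^ (2 * g)"
proof -
  obtain gs where gs: "\<And>a. length (gs a) = g" "\<And>a. set (gs a) \<subseteq> K \<times> {..<b} \<times> {..<b}"
    and dec: "\<And>a p. p \<in> pairs n \<Longrightarrow> p \<in> a \<Longrightarrow> margin * \<epsilon> \<le> Im (correlator (circuit_of b (gs a)) p)"
      "\<And>a p. p \<in> pairs n \<Longrightarrow> p \<notin> a \<Longrightarrow> margin * \<epsilon> \<le> - Im (correlator (circuit_of b (gs a)) p)"
    using circuits_for_sign_patterns[OF \<epsilon> t nb g] by metis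
  let ?L = "{xs. set xs \<subseteq> K \<times> {..<b} \<times> {..<b} \<and> length xs = g}"
  have finK: "finite (K \<times> {..<b} \<times> {..<b})" using K by simp
  have m: "0 < margin * \<epsilon>" using margin_pos \<epsilon> by simp
  have "p \<in> a \<longleftrightarrow> 0 < Im (correlator (circuit_of b (gs a)) p)" if "p \<in> pairs n" for a p
    using dec(1)[OF that, of a] dec(2)[OF that, of a] m by (cases "p \<in> a") auto
  then have "{p \<in> pairs n. 0 < Im (correlator (circuit_of b (gs a)) p)} = a" if "a \<in> Pow (pairs n)" for a
    using that by blast
  then have "inj_on gs (Pow (pairs n))"
    by (rule inj_on_inverseI[where g = "\<lambda>gs. {p \<in> pairs n. 0 < Im (correlator (circuit_of b gs) p)}"])
  then have "card (Pow (pairs n)) \<le> card ?L"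
    using gs finite_lists_length_eq[OF finK, of g] by (intro card_inj_on_le[of gs]) auto
  also have "\<dots> = (card K * (b * b)) ^ g"
    using card_lists_length_eq[OF finK, of g] by (simp add: card_cartesian_product)
  \<comment> \<open>Enlarging \<open>card K\<close> to its square makes \<open>b * card K\<close>
    the argument of the later logarithm.\<close>
  also have "\<dots> \<le> ((b * card K) ^ 2) ^ g"
    by (intro power_mono) (auto simp: power2_eq_square)
  finally show ?thesis
    by (simp add: card_Pow finite_pairs power_mult)
qed

text \<open>The patterns are grouped by the wiring of their circuits. The cube bound applies within
  each of the \<open>b ^ (2 * g)\<close> groups, and summing over the groups counts all
  patterns.\<close>

lemma any_gate_set_count:
  assumes n: "1 \<le> n" and \<epsilon>: "0 < \<epsilon>" "\<epsilon> < 1 / 3" and t: "6 / 5 * \<epsilon> \<le> t" and nb: "n \<le> b"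
    and g: "\<And>H. H \<in> zz_hamiltonians n t \<Longrightarrow>
      \<exists>V. is_circuit b K g V \<and> approximates n b \<epsilon> V (mat_exp ((- \<i>) \<cdot>\<^sub>m H))"
  shows "(1 + margin / 30) ^ card (pairs n) \<le> real b ^ (66 * g)"
proof -
  obtain gs where gs: "\<And>a. length (gs a) = g" "\<And>a. set (gs a) \<subseteq> K \<times> {..<b} \<times> {..<b}"
    and dec: "\<And>a p. p \<in> pairs n \<Longrightarrow> p \<in> a \<Longrightarrow> margin * \<epsilon> \<le> Im (correlator (circuit_of b (gs a)) p)
      \<and> Im (correlator (circuit_of b (gs a)) p) \<le> 30 * \<epsilon>"
    "\<And>a p. p \<in> pairs n \<Longrightarrow> p \<notin> a \<Longrightarrow> margin * \<epsilon> \<le> - Im (correlator (circuit_of b (gs a)) p)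
      \<and> - Im (correlator (circuit_of b (gs a)) p) \<le> 30 * \<epsilon>"
    using circuits_for_sign_patterns[OF \<epsilon> t nb g] by metis
  \<comment> \<open>The interval from \<open>- 30 * \<epsilon>\<close> to
    \<open>30 * \<epsilon>\<close> is mapped to the unit interval, where the margin becomes
    \<open>margin / 60\<close>, free of \<open>\<epsilon>\<close>.\<close>
  define y where "y a p = 1 / 2 + 1 / (60 * \<epsilon>) * Im (correlator (circuit_of b (gs a)) p)" for a p
  define \<eta> where "\<eta> = margin / 60"
  let ?P = "pairs n"
  let ?W = "{w. set w \<subseteq> {..<b} \<times> {..<b} \<and> length w = g}"
  define S where "S w = {a \<in> Pow ?P. map snd (gs a) = w}" for w
  have \<eta>: "0 \<le> \<eta>" using margin_pos by (simp add: \<eta>_def)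
  have y_in: "1 / 2 + \<eta> \<le> y a p \<and> y a p \<le> 1" if "p \<in> ?P" "p \<in> a" for a p
    using dec(1)[OF that] \<epsilon> by (simp add: y_def \<eta>_def field_simps)
  have y_out: "0 \<le> y a p \<and> y a p \<le> 1 / 2 - \<eta>" if "p \<in> ?P" "p \<notin> a" for a p
    using dec(2)[OF that] \<epsilon> by (simp add: y_def \<eta>_def field_simps)
  have fibre: "card (S w) * (1 / 2 + \<eta>) ^ card ?P \<le> real ((2 * card ?P + 1) ^ (32 * g))"
    if w: "w \<in> ?W" for w
  proof -
    have "\<forall>p\<in>?P. \<exists>F\<in>polys (gate_vars g) (\<lambda>_. 2). \<forall>z. (\<forall>i. z (flip i) = cnj (z i)) \<longrightarrow>
        F z = complex_of_real (1 / 2 + 1 / (60 * \<epsilon>) * Im (correlator (wired_circuit b w z) p))"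
      using w nb by (intro ballI Im_correlator_polys) (auto simp: pairs_def)
    \<comment> \<open>\<open>F\<close> depends on the wiring \<open>w\<close> only; the pattern
      \<open>a\<close> enters through evaluation at \<open>gate_entries (gs a)\<close>.\<close>
    then obtain F where F: "\<And>p. p \<in> ?P \<Longrightarrow> F p \<in> polys (gate_vars g) (\<lambda>_. 2)"
      "\<And>p z. p \<in> ?P \<Longrightarrow> (\<And>i. z (flip i) = cnj (z i)) \<Longrightarrow>
        F p z = complex_of_real (1 / 2 + 1 / (60 * \<epsilon>) * Im (correlator (wired_circuit b w z) p))"
      by metis
    have Fy: "F p (gate_entries (gs a)) = complex_of_real (y a p)" if "a \<in> S w" "p \<in> ?P" for a p
    proof -
      have "circuit_of b (gs a) = wired_circuit b w (gate_entries (gs a))"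
        using that(1) by (auto simp: circuit_of_def foldr_eq_wired_circuit_gate_entries S_def)
      then show ?thesis using F(2)[OF that(2), of "gate_entries (gs a)"] by (simp add: gate_entries_flip y_def)
    qed
    have "card (S w) * (1 / 2 + \<eta>) ^ card ?P \<le> (\<Prod>i\<in>gate_vars g. card ?P * 2 + 1)"
    proof (rule card_cube_vertices_bound[OF finite_gate_vars finite_pairs _ F(1) Fy _ \<eta>])
      show "0 \<le> y a p \<and> y a p \<le> 1" if "a \<in> S w" "p \<in> ?P" for a p
        using y_in[OF that(2), of a] y_out[OF that(2), of a] \<eta> by (cases "p \<in> a") auto
    qed (use y_in y_out in \<open>auto simp: S_def\<close>)
    then show ?thesis by (simp add: card_gate_vars mult.commute)
  qed
  have finW: "finite ?W" and cardW: "card ?W = (b ^ 2) ^ g"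
    using finite_lists_length_eq[of "{..<b} \<times> {..<b}" g] card_lists_length_eq[of "{..<b} \<times> {..<b}" g]
    by (auto simp: card_cartesian_product power2_eq_square)
  have "Pow ?P \<subseteq> (\<Union>w\<in>?W. S w)"
  proof
    fix a assume "a \<in> Pow ?P"
    moreover have "set (map snd (gs a)) \<subseteq> {..<b} \<times> {..<b}" using gs(2)[of a] by fastforce
    ultimately show "a \<in> (\<Union>w\<in>?W. S w)" using gs(1)[of a] by (auto simp: S_def)
  qed
  then have "card (Pow ?P) \<le> card (\<Union>w\<in>?W. S w)"
    by (intro card_mono) (auto simp: S_def finW finite_pairs)
  also have "\<dots> \<le> (\<Sum>w\<in>?W. card (S w))" by (rule card_UN_le[OF finW])
  finally have "real (2 ^ card ?P) \<le> (\<Sum>w\<in>?W. real (card (S w)))"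
    by (simp only: card_Pow finite_pairs of_nat_le_iff flip: of_nat_sum)
  then have "2 ^ card ?P * (1 / 2 + \<eta>) ^ card ?P \<le> (\<Sum>w\<in>?W. real (card (S w))) * (1 / 2 + \<eta>) ^ card ?P"
    using \<eta> by (intro mult_right_mono) auto
  also have "\<dots> = (\<Sum>w\<in>?W. card (S w) * (1 / 2 + \<eta>) ^ card ?P)"
    by (simp add: sum_distrib_right)
  also have "\<dots> \<le> (\<Sum>w\<in>?W. real ((2 * card ?P + 1) ^ (32 * g)))"
    by (intro sum_mono fibre)
  also have "\<dots> = real ((b ^ 2) ^ g * (2 * card ?P + 1) ^ (32 * g))"
    by (simp add: cardW)
  \<comment> \<open>The number of exponents per variable is at most \<open>b ^ 2\<close>, since
    \<open>n * (n - 1) + 1 \<le> n ^ 2\<close> for positive \<open>n\<close>. The exponents of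
    \<open>b\<close> add up to \<open>2 * g + 64 * g\<close>.\<close>
  also have "(b ^ 2) ^ g * (2 * card ?P + 1) ^ (32 * g) \<le> (b ^ 2) ^ g * (b ^ 2) ^ (32 * g)"
  proof (intro mult_left_mono power_mono)
    obtain k where k: "n = Suc k" using n by (cases n) auto
    have "2 * card ?P + 1 \<le> n ^ 2" unfolding card_pairs k by (simp add: power2_eq_square)
    also have "\<dots> \<le> b ^ 2" using nb by (intro power_mono) auto
    finally show "2 * card ?P + 1 \<le> b ^ 2" .
  qed auto
  also have "(b ^ 2) ^ g * (b ^ 2) ^ (32 * g) = b ^ (66 * g)"
    by (simp flip: power_mult power_add)
  also have "2 ^ card ?P * (1 / 2 + \<eta>) ^ card ?P = (1 + margin / 30) ^ card ?P"
    by (simp add: \<eta>_def algebra_simps flip: power_mult_distrib)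
  finally show ?thesis by simp
qed

section \<open>From counting inequalities to lower bounds on the gates\<close>

lemma gate_bound_of_count:
  assumes X: "1 < X" and q: "0 < q" and count: "X ^ card (pairs n) \<le> real N ^ (q * g)"
  shows "ln X / (2 * q) * ((real n)\<^sup>2 / ln (real N) - real n * 2) \<le> real g"
\<comment> \<open>For \<open>N \<le> 1\<close> the logarithm is 0, and so is the quotient by the
  convention for division by zero; the left side is then at most 0.\<close>
proof (cases "N \<le> 1")
  case True
  then have "N = 0 \<or> N = 1" by auto
  then have "ln (real N) = 0" by auto
  moreover have "- (ln X / (2 * q) * (real n * 2)) \<le> 0" using X by (simp add: divide_nonneg_nonneg)
  ultimately show ?thesis by simp
next
  case False
  then have N: "real N \<ge> 2" by simp
  have "exp (1 / 2 :: real) \<le> 2"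
    using exp_bound[of "1 / 2"] by (simp add: power2_eq_square)
  then have "ln (exp (1 / 2)) \<le> ln (2 :: real)" by (subst ln_le_cancel_iff) auto
  then have "1 / 2 \<le> ln (2 :: real)" by simp
  also have "\<dots> \<le> ln (real N)" using N by simp
  finally have L: "1 / 2 \<le> ln (real N)" .
  have "card (pairs n) * ln X = ln (X ^ card (pairs n))" using X by (simp add: ln_realpow)
  also have "\<dots> \<le> ln (real N ^ (q * g))" using count X N by (subst ln_le_cancel_iff) auto
  also have "\<dots> = q * g * ln (real N)" using N by (simp add: ln_realpow)
  finally have le: "card (pairs n) * ln X \<le> q * g * ln (real N)" .
  have "2 * real (card (pairs n)) = real (2 * card (pairs n))" by simp
  also have "\<dots> = (real n)\<^sup>2 - real n"
    unfolding card_pairs by (cases n) (auto simp: power2_eq_square algebra_simps)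
  finally have pairs: "2 * real (card (pairs n)) = (real n)\<^sup>2 - real n" .
  \<comment> \<open>The summand \<open>- real n\<close> in \<open>2 * card (pairs n)\<close> becomes
    the linear correction term, using that the logarithm is at least 1/2.\<close>
  have "real n / ln (real N) \<le> real n * 2"
    using L mult_left_mono[of "1 / 2" "ln (real N)" "real n * 2"] by (simp add: divide_le_eq)
  then have "(real n)\<^sup>2 / ln (real N) - real n * 2 \<le> 2 * real (card (pairs n)) / ln (real N)"
    unfolding pairs by (simp add: diff_divide_distrib)
  then have "ln X / (2 * q) * ((real n)\<^sup>2 / ln (real N) - real n * 2)
    \<le> ln X / (2 * q) * (2 * real (card (pairs n)) / ln (real N))"
    using X by (intro mult_left_mono) auto
  also have "\<dots> = (card (pairs n) * ln X) / (q * ln (real N))" by simp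
  also have "\<dots> \<le> (q * g * ln (real N)) / (q * ln (real N))"
    using le L by (intro divide_right_mono) auto
  also have "\<dots> = g" using q L by simp
  finally show ?thesis .
qed

text \<open>If no gate number works, the minimum is infinite and above every bound; otherwise the
  infimum is attained by well-ordering.\<close>

lemma min_gates_ge:
  assumes "\<And>g. (\<And>H. H \<in> zz_hamiltonians n t \<Longrightarrow>
      \<exists>V. is_circuit b K g V \<and> approximates n b \<epsilon> V (mat_exp ((- \<i>) \<cdot>\<^sub>m H))) \<Longrightarrow> B \<le> real g"
  shows "ereal B \<le> ereal_of_enat (min_gates n b \<epsilon> t K)"
proof -
  let ?G = "{g. \<forall>H \<in> zz_hamiltonians n t.
     \<exists>V. is_circuit b K g V \<and> approximates n b \<epsilon> V (mat_exp ((- \<i>) \<cdot>\<^sub>m H))}"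
  show ?thesis
  proof (cases "?G = {}")
    case True
    show ?thesis unfolding min_gates_def True by (simp add: top_enat_def)
  next
    case False
    have Inf_mem: "Inf X \<in> X" if "X \<noteq> {}" for X :: "enat set"
      using that LeastI_ex[of "\<lambda>x. x \<in> X"] by (auto simp: Inf_enat_def)
    have "min_gates n b \<epsilon> t K \<in> enat ` ?G"
      unfolding min_gates_def by (rule Inf_mem) (simp only: image_is_empty False not_False_eq_True)
    then obtain g where g: "min_gates n b \<epsilon> t K = enat g" "g \<in> ?G" by (rule imageE)
    have "B \<le> real g" by (rule assms) (use g(2) in blast)
    then show ?thesis by (simp add: g(1))
  qed
qed

theorem corollary1:
  shows "\<exists>C\<^sub>0 > 0.
    (\<exists>c > 0. \<exists>C > 0. \<exists>p :: nat. \<forall>(n :: nat) (b :: nat) (\<epsilon> :: real) (t :: real) K.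
       1 \<le> n \<and> n \<le> b \<and> 0 < \<epsilon> \<and> \<epsilon> < 1 / 3 \<and> t \<ge> C\<^sub>0 * \<epsilon> \<and> K \<subseteq> two_qubit_gates \<and> finite K \<longrightarrow>
       ereal_of_enat (min_gates n b \<epsilon> t K) \<ge>
         ereal (c * ((real n)\<^sup>2 / ln (real b * real (card K)) - real n * (C * ln (real n / \<epsilon>) ^ p)))) \<and>
    (\<exists>c > 0. \<exists>C > 0. \<exists>p :: nat. \<forall>(n :: nat) (b :: nat) (\<epsilon> :: real) (t :: real).
       1 \<le> n \<and> n \<le> b \<and> 0 < \<epsilon> \<and> \<epsilon> < 1 / 3 \<and> t \<ge> C\<^sub>0 * \<epsilon> \<longrightarrow>
       ereal_of_enat (min_gates n b \<epsilon> t two_qubit_gates) \<ge>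
         ereal (c * ((real n)\<^sup>2 / ln (real b) - real n * (C * ln (real n / \<epsilon>) ^ p))))"
\<comment> \<open>The constant is the ratio of the coupling size in \<open>signed_couplings\<close>
  to \<open>\<epsilon>\<close>.\<close>
proof (rule exI[of _ "6 / 5"], intro conjI)
  show "(0::real) < 6 / 5" by simp
  \<comment> \<open>With \<open>C = 2\<close> and \<open>p = 0\<close> the polylogarithmic factor is
    the constant 2. The factor \<open>ln 2 / 4\<close> is \<open>ln X / (2 * q)\<close> for
    \<open>X = 2\<close> and \<open>q = 2\<close>.\<close>
  have main1: "ereal (ln 2 / 4 * ((real n)\<^sup>2 / ln (real b * real (card K)) - real n * (2 * ln (real n / \<epsilon>) ^ 0)))
      \<le> ereal_of_enat (min_gates n b \<epsilon> t K)"
    if "n \<le> b" "0 < \<epsilon>" "\<epsilon> < 1 / 3" "t \<ge> 6 / 5 * \<epsilon>" "finite K" for n b \<epsilon> t K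
  proof (rule min_gates_ge)
    fix g assume g: "\<And>H. H \<in> zz_hamiltonians n t \<Longrightarrow>
      \<exists>V. is_circuit b K g V \<and> approximates n b \<epsilon> V (mat_exp ((- \<i>) \<cdot>\<^sub>m H))"
    have "2 ^ card (pairs n) \<le> (b * card K) ^ (2 * g)"
      by (rule finite_gate_set_count[OF that(2,3,4,1,5) g])
    then have "real (2 ^ card (pairs n)) \<le> real ((b * card K) ^ (2 * g))"
      by (rule of_nat_mono)
    then have "(2::real) ^ card (pairs n) \<le> real (b * card K) ^ (2 * g)"
      by (simp only: of_nat_power of_nat_numeral)
    then show "ln 2 / 4 * ((real n)\<^sup>2 / ln (real b * real (card K)) - real n * (2 * ln (real n / \<epsilon>) ^ 0)) \<le> g"
      using gate_bound_of_count[of 2 2 n "b * card K" g] by simp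
  qed
  show "\<exists>c > 0. \<exists>C > 0. \<exists>p :: nat. \<forall>(n :: nat) (b :: nat) (\<epsilon> :: real) (t :: real) K.
       1 \<le> n \<and> n \<le> b \<and> 0 < \<epsilon> \<and> \<epsilon> < 1 / 3 \<and> t \<ge> 6 / 5 * \<epsilon> \<and> K \<subseteq> two_qubit_gates \<and> finite K \<longrightarrow>
       ereal_of_enat (min_gates n b \<epsilon> t K) \<ge>
         ereal (c * ((real n)\<^sup>2 / ln (real b * real (card K)) - real n * (C * ln (real n / \<epsilon>) ^ p)))"
    by (rule exI[of _ "ln 2 / 4"], rule conjI, simp, rule exI[of _ 2], rule conjI, simp,
        rule exI[of _ 0], intro allI impI, elim conjE, rule main1; assumption)
  \<comment> \<open>This is \<open>ln X / (2 * q)\<close> for \<open>X = 1 + margin / 30\<close> and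
    \<open>q = 66\<close>.\<close>
  define c where "c = ln (1 + margin / 30) / 132"
  have c: "0 < c" using margin_pos by (simp add: c_def)
  have main2: "ereal (c * ((real n)\<^sup>2 / ln (real b) - real n * (2 * ln (real n / \<epsilon>) ^ 0)))
      \<le> ereal_of_enat (min_gates n b \<epsilon> t two_qubit_gates)"
    if "1 \<le> n" "n \<le> b" "0 < \<epsilon>" "\<epsilon> < 1 / 3" "t \<ge> 6 / 5 * \<epsilon>" for n b \<epsilon> t
  proof (rule min_gates_ge)
    fix g assume g: "\<And>H. H \<in> zz_hamiltonians n t \<Longrightarrow>
      \<exists>V. is_circuit b two_qubit_gates g V \<and> approximates n b \<epsilon> V (mat_exp ((- \<i>) \<cdot>\<^sub>m H))"
    have "(1 + margin / 30) ^ card (pairs n) \<le> real b ^ (66 * g)"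
      by (rule any_gate_set_count[OF that(1,3,4,5,2) g])
    then show "c * ((real n)\<^sup>2 / ln (real b) - real n * (2 * ln (real n / \<epsilon>) ^ 0)) \<le> g"
      using gate_bound_of_count[of "1 + margin / 30" 66 n b g] margin_pos by (simp add: c_def)
  qed
  show "\<exists>c > 0. \<exists>C > 0. \<exists>p :: nat. \<forall>(n :: nat) (b :: nat) (\<epsilon> :: real) (t :: real).
       1 \<le> n \<and> n \<le> b \<and> 0 < \<epsilon> \<and> \<epsilon> < 1 / 3 \<and> t \<ge> 6 / 5 * \<epsilon> \<longrightarrow>
       ereal_of_enat (min_gates n b \<epsilon> t two_qubit_gates) \<ge>
         ereal (c * ((real n)\<^sup>2 / ln (real b) - real n * (C * ln (real n / \<epsilon>) ^ p)))"
    by (rule exI[of _ c], rule conjI, rule c, rule exI[of _ 2], rule conjI, simp,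
        rule exI[of _ 0], intro allI impI, elim conjE, rule main2; assumption)
qed

end
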